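(* Let $q$ be a complex number with $|q|<1$, and let $a,b,c,x$ be complex numbers such that $\max\{|aq/bcx|,\,|ax/bcq|\}<1$. Then $$ {}_4\psi_4\left[\begin{matrix} qa^{\frac{1}{2}}, -qa^{\frac{1}{2}}, b, c \\ a^{\frac{1}{2}}, -a^{\frac{1}{2}}, aq/b, aq/c \end{matrix} ; q, \frac{ax}{bcq} \right] = \frac{(q/a, aq/bc, q/bx, q/cx, x/q, ax^2; q)_\infty}{(q/b, q/c, aq/bcx, q/ax, aqx, x^2/q; q)_\infty} \times {}_8\psi_8\left[\begin{matrix} q(ax)^{\frac{1}{2}}, -q(ax)^{\frac{1}{2}}, (aq)^{\frac{1}{2}}, -(aq)^{\frac{1}{2}}, qa^{\frac{1}{2}}, -qa^{\frac{1}{2}}, bx, cx \\ (ax)^{\frac{1}{2}}, -(ax)^{\frac{1}{2}}, x(aq)^{\frac{1}{2}}, -x(aq)^{\frac{1}{2}}, xa^{\frac{1}{2}}, -xa^{\frac{1}{2}}, aq/b, aq/c \end{matrix} ; q, \frac{ax}{bcq} \right]. $$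
   Context: For $|q|<1$, integer $n$ and complex $x$: $(x;q)_\infty=\prod_{i\ge 0}(1-xq^i)$, $(x;q)_n=(x;q)_\infty/(xq^n;q)_\infty$, and $(x_1,\dots,x_r;q)_n=(x_1;q)_n\cdots(x_r;q)_n$ (also for $n=\infty$). The bilateral series is ${}_r\psi_r\left[\begin{matrix} a_1,\dots,a_r\\ b_1,\dots,b_r\end{matrix};q,z\right]=\sum_{k=-\infty}^{\infty}\frac{(a_1,\dots,a_r;q)_k}{(b_1,\dots,b_r;q)_k}z^k$. Square roots denote fixed choices of branch, used consistently. Parameters are assumed such that all denominators are nonzero. *)

theory Defs
  imports "HOL-Analysis.Analysis"
begin

definition qpoch_inf :: "complex \<Rightarrow> complex \<Rightarrow> complex"
  where "qpoch_inf x q = (\<Prod>i. 1 - x * q ^ i)"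

definition qpoch_infs :: "complex list \<Rightarrow> complex \<Rightarrow> complex"
  where "qpoch_infs xs q = prod_list (map (\<lambda>x. qpoch_inf x q) xs)"

text \<open>
  The shifted factorial \<open>(x;q)\<^sub>n\<close> for integer \<open>n\<close> is written as a finite product or its
  reciprocal. It equals \<open>(x;q)\<^sub>\<infinity> / (xq\<^sup>n;q)\<^sub>\<infinity>\<close> whenever that quotient makes sense (lemma
  \<open>qpoch_eq_quotient\<close> below), and it also gives the usual value when the quotient is 0/0,
  as for \<open>x = q\<^sup>-\<^sup>m\<close>, \<open>0 \<le> n \<le> m\<close>, so that terminating series are covered.
\<close>

definition qpoch :: "complex \<Rightarrow> complex \<Rightarrow> int \<Rightarrow> complex"
  where "qpoch x q n =
    (if n \<ge> 0 then \<Prod>i<nat n. 1 - x * q ^ i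
     else 1 / (\<Prod>i=1..nat (-n). 1 - x / q ^ i))"

definition qpochs :: "complex list \<Rightarrow> complex \<Rightarrow> int \<Rightarrow> complex"
  where "qpochs xs q n = prod_list (map (\<lambda>x. qpoch x q n) xs)"

definition psi_term :: "complex list \<Rightarrow> complex list \<Rightarrow> complex \<Rightarrow> complex \<Rightarrow> int \<Rightarrow> complex"
  where "psi_term as bs q z k = qpochs as q k / qpochs bs q k * z powi k"

definition psi_converges :: "complex list \<Rightarrow> complex list \<Rightarrow> complex \<Rightarrow> complex \<Rightarrow> bool"
  where "psi_converges as bs q z \<longleftrightarrow> psi_term as bs q z summable_on UNIV"

definition psi :: "complex list \<Rightarrow> complex list \<Rightarrow> complex \<Rightarrow> complex \<Rightarrow> complex"
  where "psi as bs q z = (\<Sum>\<^sub>\<infinity>k\<in>UNIV. psi_term as bs q z k)"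

text \<open>
  No zero factor occurs in a denominator of a term of the bilateral series: for \<open>k < 0\<close> the
  upper parameters contribute the denominators \<open>1 - p/q\<^sup>i\<close> with \<open>i \<ge> 1\<close>, and for \<open>k \<ge> 0\<close> the
  lower ones contribute \<open>1 - r q\<^sup>i\<close> with \<open>i \<ge> 0\<close>. A lower parameter \<open>r = q\<^sup>i\<close> with \<open>i \<ge> 1\<close> is
  allowed: then \<open>1/(r;q)\<^sub>k\<close> is the finite product \<open>(1 - r/q)\<cdots>(1 - r/q\<^sup>-\<^sup>k)\<close>, which is 0 for
  \<open>k \<le> -i\<close>, so the series terminates from below; the convention \<open>1/0 = 0\<close> in
  \<open>qpoch\<close> and \<open>psi_term\<close> yields exactly this value.
\<close>

definition psi_denoms_nonzero :: "complex list \<Rightarrow> complex list \<Rightarrow> complex \<Rightarrow> bool"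
  where "psi_denoms_nonzero as bs q \<longleftrightarrow>
    (\<forall>p\<in>set as. \<forall>i\<ge>1. 1 - p / q ^ i \<noteq> 0) \<and>
    (\<forall>r\<in>set bs. \<forall>i. 1 - r * q ^ i \<noteq> 0)"

lemma convergent_prod_qpoch:
  assumes "norm q < 1"
  shows "convergent_prod (\<lambda>i. 1 - x * q ^ i :: complex)"
proof -
  have "summable (\<lambda>i. norm x * norm q ^ i)"
    using assms by (intro summable_mult summable_geometric) auto
  hence "abs_convergent_prod (\<lambda>i. 1 - x * q ^ i)"
    by (simp add: abs_convergent_prod_conv_summable norm_mult norm_power)
  thus ?thesis
    by (rule abs_convergent_prod_imp_convergent_prod)
qed

lemma qpoch_inf_split:
  assumes "norm q < 1"
  shows "qpoch_inf x q = (\<Prod>i<m. 1 - x * q ^ i) * qpoch_inf (x * q ^ m) q"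
  using has_prod_unique[OF has_prod_ignore_initial_segment'
      [OF convergent_prod_qpoch[OF assms], of x m]]
  by (simp add: qpoch_inf_def power_add mult_ac)

lemma qpoch_eq_quotient:
  assumes "norm q < 1" "q \<noteq> 0" "qpoch_inf (x * q powi n) q \<noteq> 0"
  shows "qpoch x q n = qpoch_inf x q / qpoch_inf (x * q powi n) q"
proof (cases "n \<ge> 0")
  case True
  with assms show ?thesis
    using qpoch_inf_split[OF assms(1), of x "nat n"]
    by (simp add: qpoch_def power_int_def)
next
  case False
  define m where "m = nat (-n)"
  have y: "x * q powi n = x / q ^ m"
    using False by (simp add: power_int_def m_def field_simps)
  have "(\<Prod>i<m. 1 - (x / q ^ m) * q ^ i) = (\<Prod>i=1..m. 1 - x / q ^ i)"
    by (rule prod.reindex_bij_witness[of _ "\<lambda>i. m - i" "\<lambda>i. m - i"])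
       (use assms(2) in \<open>auto simp: power_diff\<close>)
  hence split: "qpoch_inf (x / q ^ m) q = (\<Prod>i=1..m. 1 - x / q ^ i) * qpoch_inf x q"
    using qpoch_inf_split[OF assms(1), of "x / q ^ m" m] assms(2) by simp
  hence "qpoch_inf x q \<noteq> 0" "(\<Prod>i=1..m. 1 - x / q ^ i) \<noteq> 0"
    using assms(3) unfolding y by auto
  thus ?thesis
    using False split unfolding y by (simp add: qpoch_def m_def)
qed

end

theory Submission
  imports Defs "HOL-Complex_Analysis.Complex_Analysis"
begin

text \<open>
  Put \<open>A = ax\<close>, replace \<open>b, c\<close> by \<open>bx, cx\<close> and let \<open>y = a/(bcx)\<close>. Summed over the second index
  first, the double series with terms
  \<open>(q/x)\<^sub>s (Aq/x)\<^sub>2\<^sub>r\<^sub>+\<^sub>s / ((q)\<^sub>s (Aq)\<^sub>2\<^sub>r\<^sub>+\<^sub>s) (1 - Aq\<^sup>2\<^sup>r) (bx, cx)\<^sub>r / (aq/b, aq/c)\<^sub>r y\<^sup>r (x\<^sup>2/q)\<^sup>r\<^sup>+\<^sup>s\<close>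
  is evaluated by the q-Gauss sum and yields the \<open>\<^sub>8\<psi>\<^sub>8\<close>; collected along \<open>j = r + s\<close> it is
  evaluated by the nonterminating very-well-poised \<open>\<^sub>6\<phi>\<^sub>5\<close> sum and yields
  \<open>\<Sum> (b)\<^sub>j\<^sub>+\<^sub>1 (c)\<^sub>j\<^sub>+\<^sub>1 / (aq/b, aq/c)\<^sub>j z\<^sup>j\<close>, which a first-order contiguous relation turns into
  the \<open>\<^sub>4\<psi>\<^sub>4\<close>. The double series converges absolutely only for small \<open>x\<close>. With \<open>A\<close>, \<open>bx\<close>, \<open>cx\<close>
  held fixed both sides are power series in \<open>x\<close> on the disc \<open>|ax/bcq| < 1\<close>, so the identity
  extends to the whole disc.

  All shifted factorials are multiplied by suitable infinite products, so that every intermediate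
  identity is free of denominators and holds without genericity assumptions.
\<close>

subsection \<open>Infinite products\<close>

text \<open>The variables are chosen to fit the convergence conditions, which read
  \<open>norm (q * y) < 1\<close> and \<open>norm (y * x\<^sup>2 / q) < 1\<close>. With
  \<open>ax\<close>, \<open>bx\<close>, \<open>cx\<close> fixed, \<open>y\<close> is constant: the
  former does not move with \<open>x\<close>, and the latter is a disc around 0 that contains a
  punctured disc where the summations may be exchanged. With \<open>a\<close>, \<open>b\<close>,
  \<open>c\<close> fixed they would cut out an annulus. The parameters with square roots of
  \<open>a\<close> and \<open>aq\<close> enter only through \<open>(aq)_2k / (ax^2)_2k\<close>,
  because (s, -s, t, -t)_inf = (s^2)_inf whenever t^2 = s^2 q. This explains the index 2r + s of the
  double series. The contiguous relation is needed because the terms left by the 6phi5 sum lack the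
  factor 1 - a q^(2k). That factor is a combination of two neighbouring terms, and a bilateral sum
  is invariant under an index shift, so the two sums differ by the constant (1 - q/x) / (1 -
  a/(bc)). The product of the two bounded quantities is (a/(bc))^2, hence a/(bc) is not 1.\<close>

locale q_base =
  fixes q :: complex
  assumes norm_q: "norm q < 1" and q_nz: "q \<noteq> 0"
begin

abbreviation P :: "complex \<Rightarrow> complex"
  where "P x \<equiv> qpoch_inf x q"

text \<open>Dominates every partial product of 1 + t |q|^i: since 1 + u <= exp u, the exponents add
  up to a geometric series.\<close>

definition E :: "real \<Rightarrow> real"
  where "E t = exp (t / (1 - norm q))"

lemma E_pos: "E t > 0" and E_mono: "s \<le> t \<Longrightarrow> E s \<le> E t"
  using norm_q by (auto simp: E_def divide_right_mono)

lemma prod_one_plus_le_E: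
  assumes "t \<ge> 0"
  shows "(\<Prod>i<n. 1 + t * norm q ^ i) \<le> E t"
proof -
  have "(\<Prod>i<n. 1 + t * norm q ^ i) \<le> exp (\<Sum>i<n. t * norm q ^ i)"
    by (rule prod_le_exp_sum) (use assms in auto)
  also have "(\<Sum>i<n. t * norm q ^ i) \<le> t / (1 - norm q)"
  proof -
    have "(\<Sum>i<n. norm q ^ i) \<le> (\<Sum>i. norm q ^ i)"
      by (intro sum_le_suminf summable_geometric) (use norm_q in auto)
    hence "(\<Sum>i<n. norm q ^ i) \<le> 1 / (1 - norm q)"
      using norm_q by (simp add: suminf_geometric)
    hence "t * (\<Sum>i<n. norm q ^ i) \<le> t * (1 / (1 - norm q))"
      using assms by (intro mult_left_mono) auto
    thus ?thesis by (simp add: sum_distrib_left)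
  qed
  finally show ?thesis by (simp add: E_def)
qed

text \<open>Pulling \<rho> out of each factor leaves a product bounded by \<open>E\<close>. A radius
  \<rho> in place of \<open>norm x\<close> keeps the bound uniform on a disc and meaningful at
  \<open>x = 0\<close>.\<close>

lemma norm_prod_diff_le:
  assumes "norm x \<le> \<rho>" "\<rho> > 0"
  shows "norm (\<Prod>i<n. x - b * q ^ i) \<le> E (norm b / \<rho>) * \<rho> ^ n"
proof -
  have "norm (\<Prod>i<n. x - b * q ^ i) = (\<Prod>i<n. norm (x - b * q ^ i))"
    by (simp add: prod_norm)
  also have "\<dots> \<le> (\<Prod>i<n. \<rho> * (1 + norm b / \<rho> * norm q ^ i))"
  proof (intro prod_mono conjI)
    fix i
    have "norm (x - b * q ^ i) \<le> norm x + norm (b * q ^ i)" by (rule norm_triangle_ineq4)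
    also have "\<dots> \<le> \<rho> * (1 + norm b / \<rho> * norm q ^ i)"
      using assms by (simp add: norm_mult norm_power field_simps)
    finally show "norm (x - b * q ^ i) \<le> \<rho> * (1 + norm b / \<rho> * norm q ^ i)" .
  qed auto
  also have "\<dots> = (\<Prod>i<n. 1 + norm b / \<rho> * norm q ^ i) * \<rho> ^ n"
    by (simp add: prod.distrib)
  also have "\<dots> \<le> E (norm b / \<rho>) * \<rho> ^ n"
    using assms by (intro mult_right_mono prod_one_plus_le_E) auto
  finally show ?thesis .
qed

lemma norm_qpoch_le: "norm (\<Prod>i<n. 1 - b * q ^ i) \<le> E (norm b)"
  using norm_prod_diff_le[of 1 1 b n] by simp

lemma P_LIMSEQ: "(\<lambda>n. \<Prod>i<n. 1 - x * q ^ i) \<longlonglongrightarrow> P x"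
  using convergent_prod_LIMSEQ[OF convergent_prod_qpoch[OF norm_q, of x]]
  by (subst (asm) LIMSEQ_lessThan_iff_atMost [symmetric]) (simp add: qpoch_inf_def)

lemma norm_P_le: "norm (P x) \<le> E (norm x)"
  by (rule LIMSEQ_le_const2[OF tendsto_norm[OF P_LIMSEQ]]) (use norm_qpoch_le in auto)

lemma norm_P_le': "norm x \<le> t \<Longrightarrow> norm (P x) \<le> E t"
  using norm_P_le[of x] E_mono[of "norm x" t] by linarith

lemma P_step: "P x = (1 - x) * P (x * q)"
  using qpoch_inf_split[OF norm_q, of x 1] by simp

lemma P_0 [simp]: "P 0 = 1"
  by (simp add: qpoch_inf_def)

lemma P_eq_0_iff: "P x = 0 \<longleftrightarrow> (\<exists>i. x * q ^ i = 1)"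
proof
  assume "P x = 0"
  show "\<exists>i. x * q ^ i = 1"
  proof (rule ccontr)
    assume "\<nexists>i. x * q ^ i = 1"
    hence "\<And>i. 1 - x * q ^ i \<noteq> 0" by (metis eq_iff_diff_eq_0)
    hence "P x \<noteq> 0" unfolding qpoch_inf_def
      by (intro prodinf_nonzero convergent_prod_qpoch norm_q)
    with \<open>P x = 0\<close> show False by simp
  qed
next
  assume "\<exists>i. x * q ^ i = 1"
  then obtain i where "x * q ^ i = 1" by blast
  thus "P x = 0"
    using qpoch_inf_split[OF norm_q, of x "Suc i"] by simp
qed

lemma P_holomorphic_UNIV: "P holomorphic_on UNIV"
proof (rule holomorphic_uniform_sequence)
  show "\<exists>d>0. cball x d \<subseteq> UNIV \<and> uniform_limit (cball x d) (\<lambda>n x. \<Prod>i<n. 1 - x * q ^ i) P sequentially" for x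
  proof (intro exI[of _ 1] conjI)
    have "uniformly_convergent_on (cball x 1) (\<lambda>N x. \<Prod>n<N. 1 - x * q ^ n)"
    proof (rule uniformly_convergent_on_prod')
      have "uniformly_convergent_on (cball x 1) (\<lambda>N z. \<Sum>n<N. norm (z * q ^ n))"
      proof (rule Weierstrass_m_test'[where M = "\<lambda>n. (norm x + 1) * norm q ^ n"])
        show "norm (norm (z * q ^ n)) \<le> (norm x + 1) * norm q ^ n" if "z \<in> cball x 1" for n z
        proof -
          have "norm z \<le> norm x + 1"
            using that norm_triangle_sub[of z x] by (auto simp: dist_norm norm_minus_commute)
          thus ?thesis by (simp add: norm_mult norm_power mult_right_mono)
        qed
        show "summable (\<lambda>n. (norm x + 1) * norm q ^ n)"
          using norm_q by (intro summable_mult summable_geometric) auto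
      qed
      thus "uniformly_convergent_on (cball x 1) (\<lambda>N z. \<Sum>n<N. norm (1 - z * q ^ n - 1))"
        by simp
    qed (auto intro!: continuous_intros)
    then obtain l where l: "uniform_limit (cball x 1) (\<lambda>N x. \<Prod>n<N. 1 - x * q ^ n) l sequentially"
      by (auto simp: uniformly_convergent_on_def)
    have "l z = P z" if "z \<in> cball x 1" for z
      using tendsto_uniform_limitI[OF l that] P_LIMSEQ[of z] LIMSEQ_unique by blast
    with l show "uniform_limit (cball x 1) (\<lambda>n x. \<Prod>i<n. 1 - x * q ^ i) P sequentially"
      by (subst uniform_limit_cong') (auto)
  qed auto
qed (auto intro!: holomorphic_intros)

lemma P_holomorphic [holomorphic_intros]:
  "f holomorphic_on S \<Longrightarrow> (\<lambda>x. P (f x)) holomorphic_on S"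
  using holomorphic_on_compose[of f S P] P_holomorphic_UNIV holomorphic_on_subset[of P UNIV]
  by (auto simp: o_def)

lemma isCont_P: "isCont P x"
  using P_holomorphic_UNIV holomorphic_on_imp_continuous_on continuous_on_eq_continuous_at open_UNIV
  by blast

lemma tendsto_P [tendsto_intros]: "(f \<longlongrightarrow> x) F \<Longrightarrow> ((\<lambda>n. P (f n)) \<longlongrightarrow> P x) F"
  by (rule isCont_tendsto_compose[OF isCont_P])

end

context q_base begin

abbreviation fin :: "complex \<Rightarrow> nat \<Rightarrow> complex"
  where "fin x n \<equiv> (\<Prod>i<n. 1 - x * q ^ i)"

lemma P_split: "P x = fin x n * P (x * q ^ n)"
  by (rule qpoch_inf_split[OF norm_q])

lemma P_q_nz: "P q \<noteq> 0"
proof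
  assume "P q = 0"
  then obtain i where "q ^ Suc i = 1" by (auto simp: P_eq_0_iff)
  hence "norm q ^ Suc i = 1" by (metis norm_power norm_one)
  moreover have "norm q ^ Suc i < 1" using norm_q q_nz by (intro power_Suc_less_one) auto
  ultimately show False by simp
qed

lemma norm_power_q_le: "norm (x * q ^ n) \<le> norm x"
  using norm_q by (simp add: norm_mult norm_power mult_left_le power_le_one)

lemma fin_q_nz: "fin q n \<noteq> 0"
  using P_split[of q n] P_q_nz by auto

lemma norm_inverse_fin_q_le: "norm (1 / fin q n) \<le> E (norm q) / norm (P q)"
proof -
  have "1 / fin q n = P (q * q ^ n) / P q"
    using P_split[of q n] P_q_nz fin_q_nz[of n] by (simp add: field_simps)
  thus ?thesis
    using norm_P_le'[OF norm_power_q_le, of q n] by (simp add: norm_divide divide_right_mono)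
qed

subsection \<open>Two summation formulas\<close>

lemma summable_bounded_geometric:
  fixes c :: "nat \<Rightarrow> complex"
  assumes "\<And>s. norm (c s) \<le> K" "norm z < 1"
  shows "summable (\<lambda>s. c s * z ^ s)"
proof (rule summable_comparison_test')
  show "summable (\<lambda>s. K * norm z ^ s)"
    using assms by (intro summable_mult summable_geometric) auto
  show "norm (c s * z ^ s) \<le> K * norm z ^ s" if "s \<ge> 0" for s
    using assms by (simp add: norm_mult norm_power mult_right_mono)
qed

text \<open>Tannery's theorem with the majorant K |z|^s, which is independent of n. As z q^n tends
  to 0, only s = 0 survives. This is the end point of both iterated parameter shifts below.\<close>

lemma limit_shifted_series:
  fixes c :: "nat \<Rightarrow> nat \<Rightarrow> complex"
  assumes "\<And>n s. norm (c n s) \<le> K" "norm z < 1" "\<And>s. (\<lambda>n. c n s) \<longlonglongrightarrow> d s"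
  shows "(\<lambda>n. \<Sum>s. c n s * (z * q ^ n) ^ s) \<longlonglongrightarrow> d 0"
proof -
  have qn: "(\<lambda>n. q ^ n) \<longlonglongrightarrow> 0"
    using norm_q by (rule LIMSEQ_power_zero)
  have "(\<lambda>n. \<Sum>s. c n s * (z * q ^ n) ^ s) \<longlonglongrightarrow> (\<Sum>s. d s * 0 ^ s)"
  proof (rule tannerys_theorem[THEN conjunct2, THEN conjunct2])
    show "(\<lambda>n. c n s * (z * q ^ n) ^ s) \<longlonglongrightarrow> d s * 0 ^ s" for s
      using tendsto_mult[OF tendsto_const[of z] qn] by (intro tendsto_intros assms) simp
    show "\<forall>\<^sub>F (s, n) in at_top \<times>\<^sub>F sequentially. norm (c n s * (z * q ^ n) ^ s) \<le> K * norm z ^ s"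
    proof (intro always_eventually allI, clarify)
      fix s n
      have "norm (z * q ^ n) ^ s \<le> norm z ^ s"
        by (intro power_mono norm_power_q_le) auto
      moreover have "K \<ge> 0" using assms(1)[of 0 0] norm_ge_zero order_trans by blast
      ultimately show "norm (c n s * (z * q ^ n) ^ s) \<le> K * norm z ^ s"
        using assms(1)[of n s] by (simp add: norm_mult norm_power mult_mono)
    qed
    show "summable (\<lambda>s. K * norm z ^ s)"
      using assms by (intro summable_mult summable_geometric) auto
  qed auto
  thus ?thesis by (simp add: powser_zero)
qed

lemma suminf_telescope:
  fixes F F' D :: "nat \<Rightarrow> complex"
  assumes "summable F" "summable F'" "\<And>s. u * F s - v * F' s = D (Suc s) - D s"
    and "D 0 = 0" "D \<longlonglongrightarrow> 0"
  shows "u * suminf F = v * suminf F'"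
proof -
  have "(\<lambda>s. u * F s - v * F' s) sums (u * suminf F - v * suminf F')"
    by (intro sums_diff sums_mult summable_sums assms)
  moreover have "(\<lambda>s. u * F s - v * F' s) sums 0"
    using telescope_sums[OF \<open>D \<longlonglongrightarrow> 0\<close>] assms by simp
  ultimately show ?thesis using sums_unique2 by fastforce
qed

lemma bounded_coeffs:
  assumes "\<And>s. norm (f s) \<le> A" "\<And>s. norm (g s) \<le> B"
  shows "norm (f s * g s :: complex) \<le> A * B"
  unfolding norm_mult using assms by (intro mult_mono) (auto intro: order_trans[OF norm_ge_zero])

text \<open>The coefficient of the 2phi1 series with parameters a, b; c, multiplied by (c)_inf. The
  denominator (c)_s is thereby absorbed, and every value of c is admissible.\<close>

definition gauss_coeff :: "complex \<Rightarrow> complex \<Rightarrow> complex \<Rightarrow> nat \<Rightarrow> complex"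
  where "gauss_coeff a b c s = fin a s * fin b s * (1 / fin q s) * P (c * q ^ s)"

lemma gauss_coeff_bounded:
  obtains K where "\<And>c s. norm c \<le> t \<Longrightarrow> norm (gauss_coeff a b c s) \<le> K"
proof
  fix c :: complex and s assume c: "norm c \<le> t"
  show "norm (gauss_coeff a b c s) \<le> E (norm a) * E (norm b) * (E (norm q) / norm (P q)) * E t"
    unfolding gauss_coeff_def norm_mult
    using norm_P_le'[of "c * q ^ s" t] norm_power_q_le[of c s] c
    by (intro mult_mono norm_qpoch_le norm_inverse_fin_q_le) (auto intro!: mult_nonneg_nonneg divide_nonneg_nonneg less_imp_le[OF E_pos])
qed

text \<open>The ratio of consecutive summands with all products replaced by variables:
  \<open>x1\<close>, \<open>x2\<close>, \<open>x3\<close> are the new factors of (a)_s, (b)_s,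
  (q)_s, and \<open>x4\<close> is the factor split off the infinite product.\<close>

lemma gauss_coeff_ratio_algebra:
  "x3 \<noteq> 0 \<Longrightarrow> f * x1 * (g * x2) * (1 / (h * x3)) * p * (w * v) * x3 * x4 =
     f * g * (1 / h) * (x4 * p) * v * x1 * x2 * (w :: complex)"
  by (cases "h = 0") (simp_all add: field_simps)

text \<open>
  The shift \<open>c \<mapsto> cq\<close> multiplies the sum by a rational factor, by telescoping; as \<open>c q\<^sup>n \<rightarrow> 0\<close> the
  sum tends to 1. The \<open>\<^sub>6\<phi>\<^sub>5\<close> sum is treated in the same way by the shift \<open>\<alpha> \<mapsto> \<alpha>q\<close>.
\<close>

lemma gauss_sum_shift:
  assumes ab: "a \<noteq> 0" "b \<noteq> 0" and z: "norm (c / (a * b)) < 1"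
  shows "(1 - c / (a * b)) * (\<Sum>s. gauss_coeff a b c s * (c / (a * b)) ^ s) =
         (1 - c / a) * (1 - c / b) * (\<Sum>s. gauss_coeff a b (c * q) s * (c / (a * b) * q) ^ s)"
proof -
  obtain K where K: "\<And>c' s. norm c' \<le> norm c \<Longrightarrow> norm (gauss_coeff a b c' s) \<le> K"
    using gauss_coeff_bounded by blast
  define w where "w = c / (a * b)"
  define U where "U = (\<lambda>s. gauss_coeff a b (c * q) s * w ^ s)"
  \<comment> \<open>Telescoping certificate. The factor 1 - q^s gives \<open>D 0 = 0\<close>; at s +
    1 it cancels the new factor of (q)_s while 1 - c q^(s+1) completes the infinite product, so
    \<open>D (Suc s)\<close> is again a polynomial multiple of \<open>U s\<close>.\<close>
  define D where "D = (\<lambda>s. - (U s * (1 - q ^ s) * (1 - c * q ^ s)))"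
  have zq: "norm (w * q) < 1"
    using z norm_power_q_le[of w 1] unfolding w_def by (auto simp del: norm_mult)
  have cq: "norm (c * q) \<le> norm c" using norm_power_q_le[of c 1] by simp
  have sumU: "summable U"
    unfolding U_def by (rule summable_bounded_geometric[where K = K]) (use z K[OF cq] w_def in auto)
  have "(1 - w) * (\<Sum>s. gauss_coeff a b c s * w ^ s) =
        ((1 - c / a) * (1 - c / b)) * (\<Sum>s. gauss_coeff a b (c * q) s * (w * q) ^ s)"
  proof (rule suminf_telescope)
    show "summable (\<lambda>s. gauss_coeff a b c s * w ^ s)"
      by (rule summable_bounded_geometric[where K = K]) (use z K w_def in auto)
    show "summable (\<lambda>s. gauss_coeff a b (c * q) s * (w * q) ^ s)"
      by (rule summable_bounded_geometric[where K = K]) (use zq K[OF cq] in auto)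
    show "D 0 = 0" by (simp add: D_def)
    have "D \<longlonglongrightarrow> - (0 * (1 - 0) * (1 - c * 0))"
      unfolding D_def
      by (intro tendsto_intros summable_LIMSEQ_zero sumU LIMSEQ_power_zero norm_q)
    thus "D \<longlonglongrightarrow> 0" by simp
    fix s
    define Y where "Y = q ^ s"
    have Y: "1 - q * Y \<noteq> 0" using fin_q_nz[of "Suc s"] by (simp add: Y_def)
    have 1: "gauss_coeff a b c s * w ^ s = U s * (1 - c * Y)"
      unfolding gauss_coeff_def U_def using P_step[of "c * q ^ s"] by (simp add: mult_ac Y_def)
    have 2: "gauss_coeff a b (c * q) s * (w * q) ^ s = U s * Y"
      by (simp add: U_def power_mult_distrib Y_def)
    have "P (c * q * Y) = (1 - c * q * Y) * P (c * q * q ^ Suc s)"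
      using P_step[of "c * q * q ^ s"] by (simp add: mult_ac Y_def)
    hence "U (Suc s) * (1 - q * Y) * (1 - c * q * Y) = U s * (1 - a * Y) * (1 - b * Y) * w"
      unfolding U_def gauss_coeff_def prod.lessThan_Suc power_Suc[of w] Y_def [symmetric]
      by (simp only: gauss_coeff_ratio_algebra[OF Y])
    hence 3: "D (Suc s) = - (U s * (1 - a * Y) * (1 - b * Y) * w)"
      unfolding D_def by (simp add: Y_def mult_ac)
    show "(1 - w) * (gauss_coeff a b c s * w ^ s)
        - (1 - c / a) * (1 - c / b) * (gauss_coeff a b (c * q) s * (w * q) ^ s) = D (Suc s) - D s"
    proof -
      have "(1 - w) * (1 - c * Y) - (1 - c / a) * (1 - c / b) * Y =
            (1 - Y) * (1 - c * Y) - (1 - a * Y) * (1 - b * Y) * w"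
        using ab by (simp add: w_def field_simps)
      hence "U s * ((1 - w) * (1 - c * Y) - (1 - c / a) * (1 - c / b) * Y) =
            U s * ((1 - Y) * (1 - c * Y) - (1 - a * Y) * (1 - b * Y) * w)" by simp
      thus ?thesis unfolding 1 2 3 by (simp add: D_def Y_def algebra_simps)
    qed
  qed
  thus ?thesis by (simp add: w_def)
qed

lemma q_gauss_sum:
  assumes ab: "a \<noteq> 0" "b \<noteq> 0" and z: "norm (c / (a * b)) < 1"
  shows "P (c / (a * b)) * (\<Sum>s. gauss_coeff a b c s * (c / (a * b)) ^ s) = P (c / a) * P (c / b)"
proof -
  define w where "w = c / (a * b)"
  define G where "G = (\<lambda>n. \<Sum>s. gauss_coeff a b (c * q ^ n) s * (w * q ^ n) ^ s)"
  have shift: "(1 - w * q ^ n) * G n = (1 - c / a * q ^ n) * (1 - c / b * q ^ n) * G (Suc n)" for n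
  proof -
    have "norm (c * q ^ n / (a * b)) < 1"
      using z norm_power_q_le[of "c / (a * b)" n] by simp
    from gauss_sum_shift[OF ab this] show ?thesis
      by (simp add: G_def w_def mult_ac)
  qed
  have iter: "fin w n * G 0 = fin (c / a) n * fin (c / b) n * G n" for n
  proof (induction n)
    case (Suc n)
    have "fin w (Suc n) * G 0 = (1 - w * q ^ n) * (fin w n * G 0)" by simp
    also have "\<dots> = fin (c / a) n * fin (c / b) n * ((1 - w * q ^ n) * G n)"
      unfolding Suc.IH by simp
    finally show ?case unfolding shift by simp
  qed simp
  obtain K where K: "\<And>c' s. norm c' \<le> norm c \<Longrightarrow> norm (gauss_coeff a b c' s) \<le> K"
    using gauss_coeff_bounded by blast
  have qn: "(\<lambda>n. c * q ^ n * q ^ s) \<longlonglongrightarrow> c * 0 * q ^ s" for s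
    by (intro tendsto_intros LIMSEQ_power_zero norm_q)
  have "G \<longlonglongrightarrow> fin a 0 * fin b 0 * (1 / fin q 0) * P (c * 0 * q ^ 0)"
    unfolding G_def
  proof (rule limit_shifted_series)
    show "norm (gauss_coeff a b (c * q ^ n) s) \<le> K" for n s
      by (rule K[OF norm_power_q_le])
    show "(\<lambda>n. gauss_coeff a b (c * q ^ n) s) \<longlonglongrightarrow> fin a s * fin b s * (1 / fin q s) * P (c * 0 * q ^ s)" for s
      unfolding gauss_coeff_def by (intro tendsto_intros qn)
  qed (use z w_def in auto)
  hence "(\<lambda>n. fin (c / a) n * fin (c / b) n * G n) \<longlonglongrightarrow> P (c / a) * P (c / b) * 1"
    by (intro tendsto_mult P_LIMSEQ) simp
  moreover have "(\<lambda>n. fin (c / a) n * fin (c / b) n * G n) \<longlonglongrightarrow> P w * G 0"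
    unfolding iter [symmetric] by (intro tendsto_mult P_LIMSEQ tendsto_const)
  ultimately have "P w * G 0 = P (c / a) * P (c / b)"
    using LIMSEQ_unique by fastforce
  thus ?thesis by (simp add: G_def w_def)
qed


text \<open>The coefficient of the very-well-poised 6phi5 series, multiplied by (1 - \<alpha>) and
  the infinite products of its lower parameters \<alpha>q/b, \<alpha>q/c, \<alpha>q/d. The two
  parameter pairs with square roots of \<alpha> have merged into 1 - \<alpha> q^(2s).\<close>

definition vwp_coeff :: "complex \<Rightarrow> complex \<Rightarrow> complex \<Rightarrow> complex \<Rightarrow> nat \<Rightarrow> complex"
  where "vwp_coeff b c d \<alpha> s =
    fin \<alpha> s * fin b s * fin c s * fin d s * (1 / fin q s) * (1 - \<alpha> * (q ^ s * q ^ s)) *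
    (P (\<alpha> * q / b * q ^ s) * P (\<alpha> * q / c * q ^ s) * P (\<alpha> * q / d * q ^ s))"

lemma vwp_coeff_bounded:
  obtains K where "\<And>\<alpha> s. norm \<alpha> \<le> t \<Longrightarrow> norm (vwp_coeff b c d \<alpha> s) \<le> K"
proof
  fix \<alpha> :: complex and s assume \<alpha>: "norm \<alpha> \<le> t"
  have t: "t \<ge> 0" using \<alpha> norm_ge_zero order_trans by blast
  have P_le: "norm (P (\<alpha> * q / b * q ^ s)) \<le> E (t * norm (q / b))" for b
  proof (rule norm_P_le'[OF order_trans[OF norm_power_q_le]])
    have "norm (\<alpha> * q / b) = norm \<alpha> * norm (q / b)" by (simp add: norm_mult norm_divide)
    also have "\<dots> \<le> t * norm (q / b)" using \<alpha> by (intro mult_right_mono) auto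
    finally show "norm (\<alpha> * q / b) \<le> t * norm (q / b)" .
  qed
  have "norm (1 - \<alpha> * (q ^ s * q ^ s)) \<le> norm (1::complex) + norm (\<alpha> * (q ^ s * q ^ s))"
    by (rule norm_triangle_ineq4)
  also have "\<dots> \<le> 1 + t"
    using norm_power_q_le[of \<alpha> "s + s"] \<alpha> by (simp add: power_add)
  finally have vwp: "norm (1 - \<alpha> * (q ^ s * q ^ s)) \<le> 1 + t" .
  show "norm (vwp_coeff b c d \<alpha> s) \<le> E t * E (norm b) * E (norm c) * E (norm d) *
      (E (norm q) / norm (P q)) * (1 + t) *
      (E (t * norm (q / b)) * E (t * norm (q / c)) * E (t * norm (q / d)))"
    unfolding vwp_coeff_def norm_mult[of "_ * _"] norm_mult[of "fin _ _"] norm_mult[of "P _"]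
    by (intro mult_mono P_le vwp norm_qpoch_le norm_inverse_fin_q_le
          order_trans[OF norm_qpoch_le E_mono[OF \<alpha>]])
       (use t in \<open>auto intro!: mult_nonneg_nonneg divide_nonneg_nonneg less_imp_le[OF E_pos]\<close>)
qed

lemma vwp_coeff_ratio_algebra:
  "x5 \<noteq> 0 \<Longrightarrow> f * x1 * (g * x2) * (h * x3) * (k * x4) * (1 / (e * x5)) * (p * r * s) * (w * v)
     * x5 * (y1 * y2 * y3) =
     f * g * h * k * (1 / e) * ((y1 * p) * (y2 * r) * (y3 * s)) * v * x1 * x2 * x3 * x4 * (w :: complex)"
  by (cases "e = 0") (simp_all add: field_simps)

text \<open>The polynomial identity in Y = q^s behind the shift \<alpha> to \<alpha>q. Its right
  side is a difference of consecutive values of one certificate, divided by a common summand; the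
  factor \<alpha>zY - 1 is what the certificate has beyond the one for the q-Gauss sum.\<close>

lemma vwp_certificate:
  fixes b c d \<alpha> Y :: complex
  assumes "b \<noteq> 0" "c \<noteq> 0" "d \<noteq> 0" "z = \<alpha> * q / (b * c * d)"
  shows "(1 - z) * ((1 - \<alpha> * (Y * Y)) * ((1 - \<alpha> * q / b * Y) * (1 - \<alpha> * q / c * Y) * (1 - \<alpha> * q / d * Y)))
     - (1 - \<alpha> * q / (b * c)) * (1 - \<alpha> * q / (b * d)) * (1 - \<alpha> * q / (c * d)) *
         ((1 - \<alpha> * Y) * (1 - \<alpha> * q * (Y * Y)) * Y)
     = (1 - \<alpha> * Y) * (1 - b * Y) * (1 - c * Y) * (1 - d * Y) * z * (\<alpha> * z * (q * Y) - 1)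
     - (1 - Y) * ((1 - \<alpha> * q / b * Y) * (1 - \<alpha> * q / c * Y) * (1 - \<alpha> * q / d * Y)) * (\<alpha> * z * Y - 1)"
proof -
  \<comment> \<open>With the reciprocals as separate variables, the claim is a polynomial identity
    modulo \<open>b * b' = 1\<close> and its analogues.\<close>
  define b' c' d' where "b' = 1 / b" and "c' = 1 / c" and "d' = 1 / d"
  have inv: "b * b' = 1" "c * c' = 1" "d * d' = 1"
    using assms by (simp_all add: b'_def c'_def d'_def)
  have eqs: "z = \<alpha> * q * b' * c' * d'" "\<alpha> * q / b = \<alpha> * q * b'" "\<alpha> * q / c = \<alpha> * q * c'"
    "\<alpha> * q / d = \<alpha> * q * d'" "\<alpha> * q / (b * c) = \<alpha> * q * b' * c'"
    "\<alpha> * q / (b * d) = \<alpha> * q * b' * d'" "\<alpha> * q / (c * d) = \<alpha> * q * c' * d'"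
    using assms by (simp_all add: b'_def c'_def d'_def)
  show ?thesis unfolding eqs(2-7) eqs(1) using inv by algebra
qed

lemma vwp_sum_shift:
  assumes bcd: "b \<noteq> 0" "c \<noteq> 0" "d \<noteq> 0" and z: "norm (\<alpha> * q / (b * c * d)) < 1"
  shows "(1 - \<alpha> * q / (b * c * d)) * (\<Sum>s. vwp_coeff b c d \<alpha> s * (\<alpha> * q / (b * c * d)) ^ s) =
         (1 - \<alpha>) * (1 - \<alpha> * q / (b * c)) * (1 - \<alpha> * q / (b * d)) * (1 - \<alpha> * q / (c * d)) *
         (\<Sum>s. vwp_coeff b c d (\<alpha> * q) s * (\<alpha> * q / (b * c * d) * q) ^ s)"
proof -
  obtain K where K: "\<And>\<alpha>' s. norm \<alpha>' \<le> norm \<alpha> \<Longrightarrow> norm (vwp_coeff b c d \<alpha>' s) \<le> K"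
    using vwp_coeff_bounded by blast
  define w where "w = \<alpha> * q / (b * c * d)"
  define r where "r = (\<lambda>Y. (1 - \<alpha> * q / b * Y) * (1 - \<alpha> * q / c * Y) * (1 - \<alpha> * q / d * Y))"
  \<comment> \<open>The infinite products start at q^(s+1): those of the summand at \<alpha>q do so
    already, and those at \<alpha> do after splitting off \<open>r (q ^ s)\<close>. So
    \<open>U\<close> divides both summands.\<close>
  define U where "U = (\<lambda>s. fin \<alpha> s * fin b s * fin c s * fin d s * (1 / fin q s) *
    (P (\<alpha> * q / b * q ^ Suc s) * P (\<alpha> * q / c * q ^ Suc s) * P (\<alpha> * q / d * q ^ Suc s)) * w ^ s)"
  define D where "D = (\<lambda>s. U s * ((1 - q ^ s) * r (q ^ s) * (\<alpha> * w * q ^ s - 1)))"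
  have zq: "norm (w * q) < 1"
    using z norm_power_q_le[of w 1] unfolding w_def by (auto simp del: norm_mult)
  have cq: "norm (\<alpha> * q) \<le> norm \<alpha>" using norm_power_q_le[of \<alpha> 1] by simp
  have sumU: "U \<longlonglongrightarrow> 0"
  proof -
    define C where "C = E (norm \<alpha>) * E (norm b) * E (norm c) * E (norm d) * (E (norm q) / norm (P q)) *
      (E (norm (\<alpha> * q / b)) * E (norm (\<alpha> * q / c)) * E (norm (\<alpha> * q / d)))"
    have "summable U" unfolding U_def
    proof (rule summable_bounded_geometric[where K = C])
      show "norm (fin \<alpha> s * fin b s * fin c s * fin d s * (1 / fin q s) *
        (P (\<alpha> * q / b * q ^ Suc s) * P (\<alpha> * q / c * q ^ Suc s) * P (\<alpha> * q / d * q ^ Suc s))) \<le> C" for s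
        unfolding C_def norm_mult[of "_ * _"] norm_mult[of "fin _ _"] norm_mult[of "P _"]
        by (intro mult_mono norm_qpoch_le norm_inverse_fin_q_le norm_P_le' norm_power_q_le)
           (auto intro!: mult_nonneg_nonneg divide_nonneg_nonneg less_imp_le[OF E_pos])
    qed (use z w_def in auto)
    thus ?thesis by (rule summable_LIMSEQ_zero)
  qed
  have "(1 - w) * (\<Sum>s. vwp_coeff b c d \<alpha> s * w ^ s) =
        ((1 - \<alpha> * q / (b * c)) * (1 - \<alpha> * q / (b * d)) * (1 - \<alpha> * q / (c * d)) * (1 - \<alpha>)) *
        (\<Sum>s. vwp_coeff b c d (\<alpha> * q) s * (w * q) ^ s)"
  proof (rule suminf_telescope)
    show "summable (\<lambda>s. vwp_coeff b c d \<alpha> s * w ^ s)"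
      by (rule summable_bounded_geometric[where K = K]) (use z K w_def in auto)
    show "summable (\<lambda>s. vwp_coeff b c d (\<alpha> * q) s * (w * q) ^ s)"
      by (rule summable_bounded_geometric[where K = K]) (use zq K[OF cq] in auto)
    show "D 0 = 0" by (simp add: D_def)
    have "D \<longlonglongrightarrow> 0 * ((1 - 0) * r 0 * (\<alpha> * w * 0 - 1))"
      unfolding D_def r_def by (intro tendsto_intros sumU LIMSEQ_power_zero norm_q)
    thus "D \<longlonglongrightarrow> 0" by simp
    fix s
    define Y where "Y = q ^ s"
    have Y: "1 - q * Y \<noteq> 0" using fin_q_nz[of "Suc s"] by (simp add: Y_def)
    have Pr: "P (\<alpha> * q / b * Y) = (1 - \<alpha> * q / b * Y) * P (\<alpha> * q / b * q ^ Suc s)" for b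
      using P_step[of "\<alpha> * q / b * Y"] by (simp add: mult_ac Y_def)
    have 1: "vwp_coeff b c d \<alpha> s * w ^ s = U s * ((1 - \<alpha> * (Y * Y)) * r Y)"
      unfolding vwp_coeff_def U_def Y_def [symmetric] Pr r_def by (simp only: mult_ac)
    \<comment> \<open>The factor 1 - \<alpha> in the claim allows (\<alpha>q)_s to be traded for
      (\<alpha>)_s without a division, so \<alpha> = 1 stays covered.\<close>
    have fin\<alpha>: "(1 - \<alpha>) * fin (\<alpha> * q) s = fin \<alpha> s * (1 - \<alpha> * Y)"
      using prod.lessThan_Suc_shift[of "\<lambda>i. 1 - \<alpha> * q ^ i" s] by (simp add: mult_ac Y_def)
    have "(1 - \<alpha>) * (vwp_coeff b c d (\<alpha> * q) s * (w * q) ^ s) =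
      ((1 - \<alpha>) * fin (\<alpha> * q) s) * fin b s * fin c s * fin d s * (1 / fin q s) *
      (P (\<alpha> * q / b * q ^ Suc s) * P (\<alpha> * q / c * q ^ Suc s) * P (\<alpha> * q / d * q ^ Suc s)) * w ^ s *
      (1 - \<alpha> * q * (Y * Y)) * Y"
      unfolding vwp_coeff_def Y_def by (simp add: power_mult_distrib mult_ac)
    hence 2: "(1 - \<alpha>) * (vwp_coeff b c d (\<alpha> * q) s * (w * q) ^ s) =
        U s * ((1 - \<alpha> * Y) * (1 - \<alpha> * q * (Y * Y)) * Y)"
      unfolding fin\<alpha> U_def by (simp only: mult_ac)
    have Pr': "P (\<alpha> * q / b * q ^ Suc s) = (1 - \<alpha> * q / b * (q * Y)) * P (\<alpha> * q / b * q ^ Suc (Suc s))" for b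
      using P_step[of "\<alpha> * q / b * q ^ Suc s"] by (simp add: mult_ac Y_def)
    have "U (Suc s) * (1 - q * Y) * r (q * Y) =
          U s * (1 - \<alpha> * Y) * (1 - b * Y) * (1 - c * Y) * (1 - d * Y) * w"
      unfolding U_def Pr'
      unfolding prod.lessThan_Suc power_Suc[of w] Y_def [symmetric] r_def
      by (simp only: vwp_coeff_ratio_algebra[OF Y])
    hence 3: "D (Suc s) = U s * ((1 - \<alpha> * Y) * (1 - b * Y) * (1 - c * Y) * (1 - d * Y) * w * (\<alpha> * w * (q * Y) - 1))"
      unfolding D_def by (simp add: Y_def mult_ac)
    show "(1 - w) * (vwp_coeff b c d \<alpha> s * w ^ s)
        - (1 - \<alpha> * q / (b * c)) * (1 - \<alpha> * q / (b * d)) * (1 - \<alpha> * q / (c * d)) * (1 - \<alpha>) *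
          (vwp_coeff b c d (\<alpha> * q) s * (w * q) ^ s) = D (Suc s) - D s"
    proof -
      define k where "k = (1 - \<alpha> * q / (b * c)) * (1 - \<alpha> * q / (b * d)) * (1 - \<alpha> * q / (c * d))"
      have "(1 - w) * ((1 - \<alpha> * (Y * Y)) * r Y) - k * ((1 - \<alpha> * Y) * (1 - \<alpha> * q * (Y * Y)) * Y)
        = (1 - \<alpha> * Y) * (1 - b * Y) * (1 - c * Y) * (1 - d * Y) * w * (\<alpha> * w * (q * Y) - 1)
          - (1 - Y) * r Y * (\<alpha> * w * Y - 1)"
        unfolding k_def r_def by (rule vwp_certificate[OF bcd w_def])
      hence "(1 - w) * (U s * ((1 - \<alpha> * (Y * Y)) * r Y)) - k * (U s * ((1 - \<alpha> * Y) * (1 - \<alpha> * q * (Y * Y)) * Y))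
        = D (Suc s) - U s * ((1 - Y) * r Y * (\<alpha> * w * Y - 1))"
        unfolding 3 by (metis mult.left_commute right_diff_distrib)
      thus ?thesis unfolding 1 mult.assoc[of k] 2 k_def [symmetric] by (simp add: D_def Y_def)
    qed
  qed
  thus ?thesis by (simp add: w_def mult_ac)
qed

lemma vwp_sum:
  assumes bcd: "b \<noteq> 0" "c \<noteq> 0" "d \<noteq> 0" and z: "norm (\<alpha> * q / (b * c * d)) < 1"
  shows "P (\<alpha> * q / (b * c * d)) * (\<Sum>s. vwp_coeff b c d \<alpha> s * (\<alpha> * q / (b * c * d)) ^ s) =
         P \<alpha> * P (\<alpha> * q / (b * c)) * P (\<alpha> * q / (b * d)) * P (\<alpha> * q / (c * d))"
proof -
  define w where "w = \<alpha> * q / (b * c * d)"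
  define G where "G = (\<lambda>n. \<Sum>s. vwp_coeff b c d (\<alpha> * q ^ n) s * (w * q ^ n) ^ s)"
  have shift: "(1 - w * q ^ n) * G n = (1 - \<alpha> * q ^ n) * (1 - \<alpha> * q / (b * c) * q ^ n) *
      (1 - \<alpha> * q / (b * d) * q ^ n) * (1 - \<alpha> * q / (c * d) * q ^ n) * G (Suc n)" for n
  proof -
    have eq: "\<alpha> * q ^ n * q / x = \<alpha> * q / x * q ^ n" for x by simp
    have "norm (\<alpha> * q ^ n * q / (b * c * d)) < 1"
      unfolding eq using z norm_power_q_le[of "\<alpha> * q / (b * c * d)" n] by linarith
    from vwp_sum_shift[OF bcd this] show ?thesis
      unfolding eq w_def [symmetric] G_def by (simp add: mult_ac)
  qed
  have iter: "fin w n * G 0 = fin \<alpha> n * fin (\<alpha> * q / (b * c)) n * fin (\<alpha> * q / (b * d)) n *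
      fin (\<alpha> * q / (c * d)) n * G n" for n
  proof (induction n)
    case (Suc n)
    have "fin w (Suc n) * G 0 = (1 - w * q ^ n) * (fin w n * G 0)" by simp
    also have "\<dots> = fin \<alpha> n * fin (\<alpha> * q / (b * c)) n * fin (\<alpha> * q / (b * d)) n *
      fin (\<alpha> * q / (c * d)) n * ((1 - w * q ^ n) * G n)"
      unfolding Suc.IH by (simp only: mult_ac)
    finally show ?case unfolding shift prod.lessThan_Suc by (simp only: mult_ac)
  qed simp
  obtain K where K: "\<And>\<alpha>' s. norm \<alpha>' \<le> norm \<alpha> \<Longrightarrow> norm (vwp_coeff b c d \<alpha>' s) \<le> K"
    using vwp_coeff_bounded by blast
  have lim: "(\<lambda>n. vwp_coeff b c d (\<alpha> * q ^ n) s) \<longlonglongrightarrow> fin b s * fin c s * fin d s * (1 / fin q s)" for s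
  proof -
    have q0: "(\<lambda>n. q ^ n) \<longlonglongrightarrow> 0" by (rule LIMSEQ_power_zero[OF norm_q])
    have P1: "(\<lambda>n. P (\<alpha> * q ^ n * q / b * q ^ s)) \<longlonglongrightarrow> 1" for b
    proof -
      have "(\<lambda>n. P (\<alpha> * q / b * q ^ s * q ^ n)) \<longlonglongrightarrow> P (\<alpha> * q / b * q ^ s * 0)"
        by (intro tendsto_intros q0)
      thus ?thesis by (simp add: mult_ac)
    qed
    have "(\<lambda>n. vwp_coeff b c d (\<alpha> * q ^ n) s) \<longlonglongrightarrow>
        fin 0 s * fin b s * fin c s * fin d s * (1 / fin q s) * (1 - 0 * (q ^ s * q ^ s)) * (1 * 1 * 1)"
      unfolding vwp_coeff_def
      by (intro tendsto_intros P1) (use tendsto_mult[OF tendsto_const[of \<alpha>] q0] in auto)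
    thus ?thesis by simp
  qed
  have "G \<longlonglongrightarrow> fin b 0 * fin c 0 * fin d 0 * (1 / fin q 0)"
    unfolding G_def
    by (rule limit_shifted_series[OF _ _ lim]) (use z w_def K[OF norm_power_q_le] in auto)
  hence "(\<lambda>n. fin \<alpha> n * fin (\<alpha> * q / (b * c)) n * fin (\<alpha> * q / (b * d)) n * fin (\<alpha> * q / (c * d)) n * G n)
      \<longlonglongrightarrow> P \<alpha> * P (\<alpha> * q / (b * c)) * P (\<alpha> * q / (b * d)) * P (\<alpha> * q / (c * d)) * 1"
    by (intro tendsto_mult P_LIMSEQ) simp
  moreover have "(\<lambda>n. fin \<alpha> n * fin (\<alpha> * q / (b * c)) n * fin (\<alpha> * q / (b * d)) n * fin (\<alpha> * q / (c * d)) n * G n)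
      \<longlonglongrightarrow> P w * G 0"
    unfolding iter [symmetric] by (intro tendsto_mult P_LIMSEQ tendsto_const)
  ultimately have "P w * G 0 = P \<alpha> * P (\<alpha> * q / (b * c)) * P (\<alpha> * q / (b * d)) * P (\<alpha> * q / (c * d))"
    using LIMSEQ_unique by fastforce
  thus ?thesis by (simp add: G_def w_def)
qed

end

subsection \<open>Bilateral geometric bounds\<close>

lemma summable_on_intI:
  fixes f :: "int \<Rightarrow> 'a :: {topological_comm_monoid_add, t2_space}"
  assumes "(\<lambda>n::nat. f (int n)) summable_on UNIV" "(\<lambda>n::nat. f (- int (Suc n))) summable_on UNIV"
  shows "f summable_on UNIV"
proof -
  have "f summable_on range int"
    using assms(1) by (subst summable_on_reindex) (auto simp: o_def)
  moreover have "f summable_on range (\<lambda>n. - int (Suc n))"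
    using assms(2) by (subst summable_on_reindex) (auto simp: o_def inj_def)
  ultimately have "f summable_on (range int \<union> range (\<lambda>n. - int (Suc n)))"
    by (rule summable_on_Un_disjoint) auto
  also have "range int \<union> range (\<lambda>n. - int (Suc n)) = UNIV"
  proof -
    have "n \<in> range int \<union> range (\<lambda>n. - int (Suc n))" for n
      by (cases n rule: int_cases) auto
    thus ?thesis by blast
  qed
  finally show ?thesis .
qed

text \<open>The two tails of a bilateral series are unrelated, hence two ratios: r per step upwards
  and t per step downwards.\<close>

definition geo :: "real \<Rightarrow> real \<Rightarrow> int \<Rightarrow> real"
  where "geo r t n = (if n \<ge> 0 then r ^ nat n else t ^ nat (- n))"

lemma geo_nonneg: "r \<ge> 0 \<Longrightarrow> t \<ge> 0 \<Longrightarrow> geo r t n \<ge> 0"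
  by (simp add: geo_def)

lemma geo_mult: "geo r t n * geo r' t' n = geo (r * r') (t * t') n"
  by (simp add: geo_def power_mult_distrib)

lemma geo_double: "geo r t (2 * n) = geo (r\<^sup>2) (t\<^sup>2) n"
  by (simp add: geo_def nat_mult_distrib flip: power_mult)
     (metis mult_minus_right nat_mult_distrib nat_numeral zero_le_numeral)

lemma norm_powi_eq_geo: "norm ((w :: complex) powi n) = geo (norm w) (1 / norm w) n"
  by (simp add: geo_def power_int_def norm_power norm_inverse norm_divide field_simps)

lemma geo_summable:
  assumes "0 \<le> r" "r < 1" "0 \<le> t" "t < 1"
  shows "geo r t summable_on UNIV"
proof (rule summable_on_intI)
  have "summable (\<lambda>n. r ^ n)" using assms by simp
  thus "(\<lambda>n::nat. geo r t (int n)) summable_on UNIV"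
    using assms by (simp add: geo_def summable_on_UNIV_nonneg_real_iff)
  have "summable (\<lambda>n. t ^ Suc n)" using assms by (simp add: summable_Suc_iff)
  thus "(\<lambda>n::nat. geo r t (- int (Suc n))) summable_on UNIV"
    using assms by (simp add: geo_def summable_on_UNIV_nonneg_real_iff nat_add_distrib)
qed

text \<open>Under products of factors the two ratios simply multiply, so convergence of a bilateral
  series can be read off from two numbers. The constant is uniform in the parameter, as a
  Weierstrass test requires.\<close>

definition geo_bounded :: "complex set \<Rightarrow> (complex \<Rightarrow> int \<Rightarrow> complex) \<Rightarrow> real \<Rightarrow> real \<Rightarrow> bool"
  where "geo_bounded X F r t \<longleftrightarrow> (\<exists>C. \<forall>x\<in>X. \<forall>n. norm (F x n) \<le> C * geo r t n)"

lemma geo_boundedI: "(\<And>x n. x \<in> X \<Longrightarrow> norm (F x n) \<le> C * geo r t n) \<Longrightarrow> geo_bounded X F r t"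
  unfolding geo_bounded_def by blast

lemma geo_bounded_mult:
  assumes "geo_bounded X F r t" "geo_bounded X G r' t'"
  shows "geo_bounded X (\<lambda>x n. F x n * G x n) (r * r') (t * t')"
proof -
  obtain C where C: "\<And>x n. x \<in> X \<Longrightarrow> norm (F x n) \<le> C * geo r t n"
    using assms(1) unfolding geo_bounded_def by blast
  obtain C' where C': "\<And>x n. x \<in> X \<Longrightarrow> norm (G x n) \<le> C' * geo r' t' n"
    using assms(2) unfolding geo_bounded_def by blast
  show ?thesis
  proof (rule geo_boundedI)
    fix x n assume x: "x \<in> X"
    have "norm (F x n * G x n) \<le> (C * geo r t n) * (C' * geo r' t' n)"
      unfolding norm_mult using C[OF x] C'[OF x]
      by (intro mult_mono) (auto intro: order_trans[OF norm_ge_zero])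
    also have "\<dots> = (C * C') * geo (r * r') (t * t') n"
      by (simp add: geo_mult [symmetric])
    finally show "norm (F x n * G x n) \<le> (C * C') * geo (r * r') (t * t') n" .
  qed
qed

lemma geo_bounded_double:
  assumes "geo_bounded X F r t"
  shows "geo_bounded X (\<lambda>x n. F x (2 * n)) (r\<^sup>2) (t\<^sup>2)"
  using assms unfolding geo_bounded_def geo_double [symmetric] by blast

lemma geo_bounded_powi: "geo_bounded X (\<lambda>_ n. w powi n) (norm w) (1 / norm w)"
  by (rule geo_boundedI[where C = 1]) (simp add: norm_powi_eq_geo)

lemma geo_bounded_abs_summable:
  assumes "geo_bounded X F r t" "0 \<le> r" "r < 1" "0 \<le> t" "t < 1" "x \<in> X"
  shows "(\<lambda>n. norm (F x n)) summable_on UNIV"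
proof -
  obtain C where C: "\<And>n. norm (F x n) \<le> C * geo r t n"
    using assms(1,6) unfolding geo_bounded_def by blast
  show ?thesis
    by (rule Infinite_Sum.abs_summable_on_comparison_test'[OF summable_on_cmult_right[OF geo_summable[OF assms(2-5)]] C])
qed

text \<open>The geometric majorant gives uniform convergence on the closed disc along the finite
  subsets of the integers, and every finite partial sum is entire.\<close>

lemma geo_bounded_holomorphic:
  assumes "geo_bounded (cball 0 R) F r t" "0 \<le> r" "r < 1" "0 \<le> t" "t < 1"
    and "\<And>n. (\<lambda>x. F x n) holomorphic_on UNIV"
  shows "(\<lambda>x. \<Sum>\<^sub>\<infinity>n. F x n) holomorphic_on ball 0 R"
proof -
  obtain C where C: "\<And>x n. x \<in> cball 0 R \<Longrightarrow> norm (F x n) \<le> C * geo r t n"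
    using assms(1) unfolding geo_bounded_def by blast
  have "uniform_limit (cball 0 R) (\<lambda>N x. \<Sum>n\<in>N. F x n) (\<lambda>x. \<Sum>\<^sub>\<infinity>n. F x n) (finite_subsets_at_top UNIV)"
    by (rule Weierstrass_m_test_general[OF C summable_on_cmult_right[OF geo_summable[OF assms(2-5)]]])
  moreover have "(\<lambda>x. \<Sum>n\<in>N. F x n) holomorphic_on S" for N S
    by (intro holomorphic_intros holomorphic_on_subset[OF assms(6)]) auto
  ultimately show ?thesis
    by (elim holomorphic_uniform_limit[rotated])
       (auto intro!: always_eventually holomorphic_on_imp_continuous_on)
qed

section \<open>Entire normalisations of shifted factorials with integer index\<close>

context q_base begin

text \<open>The exponent of q in the reversal (z)_n = (-z)^n q^(n(n-1)/2) (q^(1-n)/z)_n.\<close>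

definition tri :: "int \<Rightarrow> int"
  where "tri n = n * (n - 1) div 2"

lemma tri_Suc: "tri (n + 1) = tri n + n"
proof -
  have "(n + 1) * (n + 1 - 1) = n * (n - 1) + n * 2" by (simp add: algebra_simps)
  thus ?thesis unfolding tri_def by simp
qed

lemma tri_0 [simp]: "tri 0 = 0" by (simp add: tri_def)

text \<open>
  \<open>hx \<beta> x n\<close> is \<open>x\<^sup>n (\<beta>/x)\<^sub>n (qx/\<beta>)\<^sub>\<infinity>\<close>, written so that it is entire in \<open>x\<close> for every integer \<open>n\<close>.
\<close>

definition hx :: "complex \<Rightarrow> complex \<Rightarrow> int \<Rightarrow> complex"
  where "hx \<beta> x n = q powi tri n * (- \<beta>) powi n * P (x * q powi (1 - n) / \<beta>)"

lemma hx_0: "hx \<beta> x 0 = P (x * q / \<beta>)"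
  by (simp add: hx_def)

text \<open>The new factor of x^n (\<beta>/x)_n is x (1 - \<beta> q^n / x), which contains no
  division by x once multiplied out.\<close>

lemma hx_step:
  assumes "\<beta> \<noteq> 0"
  shows "hx \<beta> x (n + 1) = hx \<beta> x n * (x - \<beta> * q powi n)"
proof -
  have "x * q powi (- n) / \<beta> * q = x * q powi (1 - n) / \<beta>"
    using q_nz by (simp add: power_int_diff power_int_minus divide_inverse)
  moreover have "1 - (n + 1) = - n" by simp
  ultimately have *: "P (x * q powi (1 - (n + 1)) / \<beta>) = (1 - x * q powi (- n) / \<beta>) * P (x * q powi (1 - n) / \<beta>)"
    using P_step[of "x * q powi (- n) / \<beta>"] by (simp only:)
  have "hx \<beta> x (n + 1) = q powi tri n * q powi n * ((- \<beta>) powi n * (- \<beta>)) *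
      ((1 - x * q powi (- n) / \<beta>) * P (x * q powi (1 - n) / \<beta>))"
    unfolding hx_def tri_Suc * using q_nz assms by (simp add: power_int_add)
  also have "\<dots> = hx \<beta> x n * (q powi n * (- \<beta>) * (1 - x * q powi (- n) / \<beta>))"
    unfolding hx_def by (simp only: mult_ac)
  also have "q powi n * (- \<beta>) * (1 - x * q powi (- n) / \<beta>) = x - \<beta> * q powi n"
    using assms q_nz by (simp add: power_int_minus field_simps)
  finally show ?thesis .
qed

lemma hx_holomorphic [holomorphic_intros]:
  "\<beta> \<noteq> 0 \<Longrightarrow> f holomorphic_on S \<Longrightarrow> (\<lambda>x. hx \<beta> (f x) n) holomorphic_on S"
  unfolding hx_def by (intro holomorphic_intros) auto

lemma hx_scale:
  assumes "x \<noteq> 0" 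
  shows "hx \<beta> x n = x powi n * hx (\<beta> / x) 1 n"
proof -
  have "x powi n * (- (\<beta> / x)) powi n = (- \<beta>) powi n"
    using assms by (simp flip: power_int_mult_distrib)
  thus ?thesis by (simp add: hx_def mult_ac)
qed

lemma hx_add_nat:
  assumes "\<beta> \<noteq> 0"
  shows "hx \<beta> x (n + int s) = hx \<beta> x n * (\<Prod>i<s. x - \<beta> * q powi n * q ^ i)"
proof (induction s)
  case (Suc s)
  have "hx \<beta> x (n + int (Suc s)) = hx \<beta> x (n + int s + 1)" by (simp add: add_ac)
  also have "\<dots> = hx \<beta> x (n + int s) * (x - \<beta> * q powi n * q ^ s)"
    using q_nz assms by (simp add: hx_step power_int_add)
  finally show ?case unfolding Suc.IH by simp
qed simp

text \<open>Going down, \<open>P (u * q powi (n - m))\<close> gains factors 1 - u q^(n-m) that grow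
  without bound. The exponent \<open>tri\<close> supplies the matching powers q^(m-n), which turn
  them into multiples of the bounded u - q^(m-n).\<close>

lemma P_diff_nat:
  assumes "\<beta> \<noteq> 0"
  shows "q powi tri (n - int s) * (- \<beta>) powi (n - int s) * P (u * q powi (n - int s)) =
    q powi tri n * (- \<beta>) powi n * P (u * q powi n) * (\<Prod>i<s. u - q powi (1 - n) * q ^ i) / \<beta> ^ s"
proof (induction s)
  case (Suc s)
  define m where "m = n - int s - 1"
  have m: "n - int s = m + 1" "n - int (Suc s) = m" by (simp_all add: m_def)
  have *: "P (u * q powi m) = (1 - u * q powi m) * P (u * q powi (m + 1))"
    using P_step[of "u * q powi m"] q_nz by (simp add: power_int_add mult_ac)
  have "q powi (1 - n) * q ^ s = q powi (- m)"
    using q_nz by (simp add: m_def power_int_diff power_int_add power_int_minus field_simps)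
  hence **: "(u - q powi (1 - n) * q ^ s) * q powi m = - (1 - u * q powi m)"
    using q_nz by (simp add: power_int_minus algebra_simps)
  have "q powi tri (m + 1) * (- \<beta>) powi (m + 1) * P (u * q powi (m + 1)) * (u - q powi (1 - n) * q ^ s) / \<beta> =
        q powi tri m * (- \<beta>) powi m * P (u * q powi (m + 1)) * (- ((u - q powi (1 - n) * q ^ s) * q powi m))"
    unfolding tri_Suc using q_nz assms by (simp add: power_int_add)
  also have "\<dots> = q powi tri m * (- \<beta>) powi m * P (u * q powi m)"
    unfolding ** * by simp
  finally show ?case unfolding m(2) Suc.IH[unfolded m(1)] by (simp add: mult_ac)
qed simp

lemma hx_P_diff_nat:
  assumes "\<beta> \<noteq> 0"
  shows "hx \<beta> x (n - int s) * P (u * q powi (n - int s)) =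
    q powi tri n * (- \<beta>) powi n * P (u * q powi n) * (\<Prod>i<s. u - q powi (1 - n) * q ^ i) / \<beta> ^ s *
    P (x * q powi (1 - n) / \<beta> * q ^ s)"
proof -
  have "x * q powi (1 - (n - int s)) / \<beta> = x * q powi (1 - n) / \<beta> * q ^ s"
    using q_nz by (simp add: power_int_diff power_int_add field_simps)
  hence "hx \<beta> x (n - int s) * P (u * q powi (n - int s)) =
    q powi tri (n - int s) * (- \<beta>) powi (n - int s) * P (u * q powi (n - int s)) *
    P (x * q powi (1 - n) / \<beta> * q ^ s)"
    unfolding hx_def by (simp only: mult_ac)
  thus ?thesis unfolding P_diff_nat[OF assms] .
qed

text \<open>Upwards the numerator factors f x - \<beta> q^i grow at most like \<rho>^n, and
  \<open>P\<close> stays bounded. Downwards the roles are exchanged: the factors g x - q^(i+1)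
  contribute \<sigma>, and each step divides by \<beta>.\<close>

lemma hx_P_bounded:
  assumes "\<beta> \<noteq> 0" "\<rho> > 0" "\<sigma> > 0"
    and fg: "\<And>x. x \<in> X \<Longrightarrow> norm (f x) \<le> \<rho>" "\<And>x. x \<in> X \<Longrightarrow> norm (g x) \<le> \<sigma>"
  shows "geo_bounded X (\<lambda>x n. hx \<beta> (f x) n * P (g x * q powi n)) \<rho> (\<sigma> / norm \<beta>)"
proof (rule geo_boundedI)
  fix x n assume x: "x \<in> X"
  define K where "K = E (\<rho> * norm q / norm \<beta>) * E \<sigma>"
  have K: "K > 0" by (simp add: K_def E_pos)
  have fx: "norm (f x * q / \<beta>) \<le> \<rho> * norm q / norm \<beta>"
    using fg(1)[OF x] by (simp add: norm_mult norm_divide divide_right_mono mult_right_mono)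
  have M: "norm (P (f x * q / \<beta> * q ^ k)) \<le> E (\<rho> * norm q / norm \<beta>)"
          "norm (P (g x * q ^ k)) \<le> E \<sigma>" for k
    by (rule norm_P_le'[OF order_trans[OF norm_power_q_le fx]])
       (rule norm_P_le'[OF order_trans[OF norm_power_q_le fg(2)[OF x]]])
  \<comment> \<open>One constant serves both tails: the first summand in parentheses is for n >= 0,
    the second for n < 0.\<close>
  show "norm (hx \<beta> (f x) n * P (g x * q powi n)) \<le>
     (K * (E (norm \<beta> / \<rho>) + E (norm q / \<sigma>))) * geo \<rho> (\<sigma> / norm \<beta>) n"
  proof (cases n rule: int_cases)
    case (nonneg k)
    have "norm (hx \<beta> (f x) n * P (g x * q powi n)) =
        norm (P (f x * q / \<beta> * q ^ 0)) * norm (P (g x * q ^ k)) * norm (\<Prod>i<k. f x - \<beta> * q ^ i)"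
      using hx_add_nat[OF assms(1), of "f x" 0 k] by (simp add: nonneg hx_0 norm_mult mult_ac)
    also have "\<dots> \<le> E (\<rho> * norm q / norm \<beta>) * E \<sigma> * (E (norm \<beta> / \<rho>) * \<rho> ^ k)"
      using assms(2) fg(1)[OF x]
      by (intro mult_mono M norm_prod_diff_le mult_nonneg_nonneg less_imp_le[OF E_pos]) auto
    also have "\<dots> \<le> K * (E (norm \<beta> / \<rho>) + E (norm q / \<sigma>)) * \<rho> ^ k"
      unfolding K_def [symmetric] using K assms(2) E_pos[of "norm q / \<sigma>"] by (simp add: algebra_simps)
    finally show ?thesis by (simp add: nonneg geo_def)
  next
    case (neg k')
    define k where "k = Suc k'"
    have n: "n = 0 - int k" by (simp add: neg k_def)
    have "norm (hx \<beta> (f x) n * P (g x * q powi n)) =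
        norm (P (f x * q / \<beta> * q ^ k)) * norm (P (g x * q ^ 0)) * (norm (\<Prod>i<k. g x - q * q ^ i) / norm \<beta> ^ k)"
      unfolding n hx_P_diff_nat[OF assms(1)] by (simp add: norm_mult norm_divide norm_power)
    also have "\<dots> \<le> E (\<rho> * norm q / norm \<beta>) * E \<sigma> * (E (norm q / \<sigma>) * \<sigma> ^ k / norm \<beta> ^ k)"
      using assms(3) fg(2)[OF x]
      by (intro mult_mono M norm_prod_diff_le divide_right_mono mult_nonneg_nonneg less_imp_le[OF E_pos]) auto
    also have "\<dots> \<le> K * (E (norm \<beta> / \<rho>) + E (norm q / \<sigma>)) * (\<sigma> / norm \<beta>) ^ k"
      unfolding K_def [symmetric] using K assms(3) E_pos[of "norm \<beta> / \<rho>"]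
      by (simp add: algebra_simps power_divide)
    finally show ?thesis by (simp add: neg k_def geo_def nat_add_distrib)
  qed
qed

lemma vwp_factor_bounded: "geo_bounded X (\<lambda>_ n. 1 - A * q powi (2 * n)) 1 (1 / norm q ^ 2)"
proof (rule geo_boundedI)
  fix n
  have "norm (1 - A * q powi (2 * n)) \<le> norm (1::complex) + norm (A * q powi (2 * n))"
    by (rule norm_triangle_ineq4)
  also have "\<dots> = 1 + norm A * geo (norm q ^ 2) (1 / norm q ^ 2) n"
    by (simp add: norm_mult norm_powi_eq_geo geo_double power_divide)
  also have "\<dots> \<le> (1 + norm A) * geo 1 (1 / norm q ^ 2) n"
  proof -
    have "norm q ^ k \<le> 1" for k using norm_q by (simp add: power_le_one)
    hence "geo (norm q ^ 2) (1 / norm q ^ 2) n \<le> geo 1 (1 / norm q ^ 2) n"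
      by (simp add: geo_def flip: power_mult)
    moreover have "1 \<le> (1 / norm q ^ 2) ^ k" for k
      using \<open>\<And>k. norm q ^ k \<le> 1\<close> q_nz by (intro one_le_power) simp
    hence "1 \<le> geo 1 (1 / norm q ^ 2) n"
      by (simp add: geo_def)
    ultimately show ?thesis
      by (simp add: distrib_right add_mono mult_left_mono)
  qed
  finally show "norm (1 - A * q powi (2 * n)) \<le> (1 + norm A) * geo 1 (1 / norm q ^ 2) n" .
qed

end

context q_base begin

text \<open>Quasi-periodicity of the theta function (\<beta>, q/\<beta>)_inf: the factor 1 - \<beta>
  q^n gained by \<open>hx\<close> is the one lost by \<open>P\<close>, so the product does not
  depend on n.\<close>

lemma theta_shift:
  assumes "\<beta> \<noteq> 0"
  shows "hx \<beta> 1 n * P (\<beta> * q powi n) = P (q / \<beta>) * P \<beta>"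
proof -
  have step: "hx \<beta> 1 (n + 1) * P (\<beta> * q powi (n + 1)) = hx \<beta> 1 n * P (\<beta> * q powi n)" for n
    using P_step[of "\<beta> * q powi n"] q_nz by (simp add: hx_step[OF assms] power_int_add mult_ac)
  show ?thesis
  proof (induction n rule: int_induct[where k = 0])
    case base
    show ?case by (simp add: hx_0)
  next
    case (step1 i)
    thus ?case using step by simp
  next
    case (step2 i)
    thus ?case using step[of "i - 1"] by simp
  qed
qed

lemma prod_diff_eq_fin:
  assumes "u \<noteq> 0"
  shows "(\<Prod>i<s. u - v * q ^ i) = u ^ s * fin (v / u) s"
proof -
  have "(\<Prod>i<s. u - v * q ^ i) = (\<Prod>i<s. u * (1 - v / u * q ^ i))"
    using assms by (intro prod.cong) (auto simp: field_simps)
  thus ?thesis by (simp add: prod.distrib)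
qed

end

subsection \<open>The double series\<close>

text \<open>Here \<open>A\<close>, \<open>b\<close>, \<open>c\<close> stand for \<open>ax\<close>, \<open>bx\<close>, \<open>cx\<close> of the theorem.\<close>

locale core = q_base +
  fixes A b c :: complex
  assumes nz: "A \<noteq> 0" "b \<noteq> 0" "c \<noteq> 0"
begin

definition y :: complex
  where "y = A / (b * c)"

lemma y_nz: "y \<noteq> 0" using nz by (simp add: y_def)

text \<open>The part of the summand that is free of x, shared by the single series \<open>W\<close>
  and the double series \<open>X\<close>. This separation is what makes continuation in x with A, b,
  c fixed possible.\<close>

definition base :: "int \<Rightarrow> complex"
  where "base r = (1 - A * q powi (2 * r)) * (hx b 1 r * P (A * q / b * q powi r)) *
    (hx c 1 r * P (A * q / c * q powi r))"

text \<open>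
  Up to constant factors, \<open>W x\<close> is the term of the \<open>\<^sub>8\<psi>\<^sub>8\<close> series, and \<open>V x k - q/x V x (k + 1)\<close>
  is that of the \<open>\<^sub>4\<psi>\<^sub>4\<close> series.
\<close>

definition W :: "complex \<Rightarrow> int \<Rightarrow> complex"
  where "W x r = base r * (hx (A * q) x (2 * r) * P (A * x * q powi (2 * r))) * (y / q) powi r"

definition V :: "complex \<Rightarrow> int \<Rightarrow> complex"
  where "V x k = (hx b x k * P (A / b * q powi k)) * (hx c x k * P (A / c * q powi k)) * (y / q) powi k"

text \<open>The double series times (Aq, x/A, q/b, q/c, Aq/b, Aq/c)_inf. The parameters q/x and Aq/x
  keep it singular at x = 0; only the sums over s, after normalisation, are entire in x.\<close>

definition X :: "complex \<Rightarrow> int \<Rightarrow> nat \<Rightarrow> complex"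
  where "X x r s = base r * y powi r * (fin (q / x) s * (1 / fin q s)) *
    (hx (A * q / x) 1 (2 * r + int s) * P (A * q * q powi (2 * r + int s))) * (x\<^sup>2 / q) powi (r + int s)"

lemma base_bounded: "geo_bounded Z (\<lambda>_ r. base r) 1 (norm y ^ 2)"
proof -
  have hxP: "geo_bounded Z (\<lambda>_ r. hx b 1 r * P (A * q / b * q powi r)) 1 (norm (A * q / b) / norm b)"
    if "b \<noteq> 0" for b
    by (rule hx_P_bounded[OF that]) (use that nz q_nz in auto)
  have "1 / q ^ 2 * (A * q / b / b) * (A * q / c / c) = y ^ 2"
    using nz q_nz by (simp add: y_def power2_eq_square)
  hence "norm (1 / q ^ 2 * (A * q / b / b) * (A * q / c / c)) = norm (y ^ 2)" by simp
  hence "1 / norm q ^ 2 * (norm (A * q / b) / norm b) * (norm (A * q / c) / norm c) = norm y ^ 2"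
    by (simp only: norm_mult norm_divide norm_power norm_one)
  thus ?thesis
    using geo_bounded_mult[OF geo_bounded_mult[OF vwp_factor_bounded hxP[OF nz(2)]] hxP[OF nz(3)], of A]
    unfolding base_def by (simp only: mult_1_left)
qed

text \<open>Both tails have the same ratio: downwards |y|^2 from \<open>base\<close>, (\<rho>/|q|)^2
  from the doubled index and |q/y| from the power multiply to \<rho>^2 |y/q|.\<close>

lemma W_bounded:
  assumes "\<rho> > 0"
  shows "geo_bounded (cball 0 \<rho>) W (\<rho>\<^sup>2 * norm (y / q)) (\<rho>\<^sup>2 * norm (y / q))"
proof -
  have "geo_bounded (cball 0 \<rho>) (\<lambda>x n. hx (A * q) x n * P (A * x * q powi n)) \<rho> (norm A * \<rho> / norm (A * q))"
    by (rule hx_P_bounded) (use nz q_nz assms in \<open>auto simp: norm_mult mult_left_mono\<close>)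
  from geo_bounded_double[OF this]
  have hxP: "geo_bounded (cball 0 \<rho>) (\<lambda>x n. hx (A * q) x (2 * n) * P (A * x * q powi (2 * n)))
      (\<rho>\<^sup>2) ((norm A * \<rho> / norm (A * q))\<^sup>2)" .
  have "y ^ 2 * (A / (A * q)) ^ 2 * (1 / (y / q)) = y / q"
    using nz q_nz y_nz by (simp add: power2_eq_square)
  hence "norm (y ^ 2 * (A / (A * q)) ^ 2 * (1 / (y / q))) = norm (y / q)" by simp
  hence "norm y ^ 2 * (norm A / norm (A * q)) ^ 2 * (1 / norm (y / q)) = norm (y / q)"
    by (simp only: norm_mult norm_divide norm_power norm_one)
  hence "\<rho>\<^sup>2 * (norm y ^ 2 * (norm A / norm (A * q)) ^ 2 * (1 / norm (y / q))) = \<rho>\<^sup>2 * norm (y / q)" by simp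
  hence "norm y ^ 2 * (norm A * \<rho> / norm (A * q)) ^ 2 * (1 / norm (y / q)) = \<rho>\<^sup>2 * norm (y / q)"
    by (simp add: power_mult_distrib power_divide mult_ac)
  thus ?thesis
    using geo_bounded_mult[OF geo_bounded_mult[OF base_bounded hxP] geo_bounded_powi, of "y / q"]
    unfolding W_def by (simp only: mult_1_left)
qed

text \<open>The lower ratio is free of \<rho> because A/b and A/c do not involve x. The two
  convergence conditions of the theorem thus govern one tail each.\<close>

lemma V_bounded:
  assumes "\<rho> > 0"
  shows "geo_bounded (cball 0 \<rho>) V (\<rho>\<^sup>2 * norm (y / q)) (norm (q * y))"
proof -
  have hxP: "geo_bounded (cball 0 \<rho>) (\<lambda>x n. hx b x n * P (A / b * q powi n)) \<rho> (norm (A / b) / norm b)"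
    if "b \<noteq> 0" for b
    by (rule hx_P_bounded) (use that nz assms in auto)
  have "A / b / b * (A / c / c) * (1 / (y / q)) = q * y"
    using nz q_nz by (simp add: y_def power2_eq_square)
  hence "norm (A / b / b * (A / c / c) * (1 / (y / q))) = norm (q * y)" by simp
  hence "norm (A / b) / norm b * (norm (A / c) / norm c) * (1 / norm (y / q)) = norm (q * y)"
    by (simp only: norm_mult norm_divide norm_one)
  thus ?thesis
    using geo_bounded_mult[OF geo_bounded_mult[OF hxP[OF nz(2)] hxP[OF nz(3)]] geo_bounded_powi, of "y / q"]
    unfolding V_def by (simp only: power2_eq_square)
qed

text \<open>For fixed r the parameters are q/x and A q^(2r+1)/x over A q^(2r+1), for which the
  q-Gauss argument is exactly x^2/q. Of the two products on the right, one is (x)_inf and the other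
  completes \<open>W\<close>.\<close>

lemma X_sum_s:
  assumes x: "x \<noteq> 0" "norm (x\<^sup>2 / q) < 1"
  shows "P (x\<^sup>2 / q) * (\<Sum>s. X x r s) = P x * W x r"
proof -
  define Q where "Q = q powi (2 * r)"
  have Q: "Q \<noteq> 0" using q_nz by (simp add: Q_def)
  define a' b' c' where "a' = q / x" and "b' = A * q / x * Q" and "c' = A * q * Q"
  have nz': "a' \<noteq> 0" "b' \<noteq> 0" using nz x q_nz Q by (auto simp: a'_def b'_def)
  have z: "c' / (a' * b') = x\<^sup>2 / q" "c' / a' = A * x * Q" "c' / b' = x"
    using nz x q_nz Q by (simp_all add: a'_def b'_def c'_def power2_eq_square)
  define k where "k = base r * y powi r * hx (A * q / x) 1 (2 * r) * (x\<^sup>2 / q) powi r"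
  have "X x r s = k * (gauss_coeff a' b' c' s * (c' / (a' * b')) ^ s)" for s
  proof -
    have "(x\<^sup>2 / q) powi (r + int s) = (x\<^sup>2 / q) powi r * (x\<^sup>2 / q) ^ s"
      using x q_nz by (simp add: power_int_add)
    moreover have "A * q * q powi (2 * r + int s) = c' * q ^ s"
      using q_nz by (simp add: power_int_add c'_def Q_def)
    moreover have "hx (A * q / x) 1 (2 * r + int s) = hx (A * q / x) 1 (2 * r) * fin b' s"
      using hx_add_nat[of "A * q / x" 1 "2 * r" s] nz x q_nz by (simp add: b'_def Q_def)
    ultimately show ?thesis unfolding X_def z gauss_coeff_def k_def a'_def [symmetric]
      by (simp only: mult_ac)
  qed
  hence "(\<Sum>s. X x r s) = (\<Sum>s. k * (gauss_coeff a' b' c' s * (c' / (a' * b')) ^ s))" by simp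
  also have "\<dots> = k * (\<Sum>s. gauss_coeff a' b' c' s * (c' / (a' * b')) ^ s)"
  proof (rule suminf_mult)
    obtain K where "\<And>c s. norm c \<le> norm c' \<Longrightarrow> norm (gauss_coeff a' b' c s) \<le> K"
      using gauss_coeff_bounded by blast
    thus "summable (\<lambda>s. gauss_coeff a' b' c' s * (c' / (a' * b')) ^ s)"
      using x z by (intro summable_bounded_geometric) auto
  qed
  finally have "P (x\<^sup>2 / q) * (\<Sum>s. X x r s) = k * (P (c' / a') * P (c' / b'))"
    using q_gauss_sum[OF nz', of c'] x unfolding z by (simp add: mult_ac)
  moreover have "k * P (c' / a') = W x r"
  proof -
    have "hx (A * q) x (2 * r) = (x\<^sup>2) powi r * hx (A * q / x) 1 (2 * r)"
      using hx_scale[OF x(1), of "A * q" "2 * r"] by (simp only: power_int_mult power_int_numeral)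
    hence "W x r = ((y / q) powi r * (x\<^sup>2) powi r) * (base r * (hx (A * q / x) 1 (2 * r) * P (A * x * Q)))"
      unfolding W_def Q_def by (simp only: mult_ac)
    also have "(y / q) powi r * (x\<^sup>2) powi r = y powi r * (x\<^sup>2 / q) powi r"
      unfolding power_int_mult_distrib [symmetric] by simp
    finally have "W x r = base r * (y powi r * (x\<^sup>2 / q) powi r * (hx (A * q / x) 1 (2 * r) * P (A * x * Q)))"
      by (simp only: mult_ac)
    thus ?thesis unfolding k_def z by (simp only: mult_ac)
  qed
  ultimately show ?thesis unfolding z by (simp add: mult_ac)
qed

text \<open>Along r + s = j the index r decreases with s. Reversing the factorials with index j - s
  or 2j - s gives a 6phi5 series with argument xy. Its products (x q^(-j)/b)_inf and (x
  q^(-j)/c)_inf are those of \<open>hx\<close> at index j + 1, whence the offset in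
  \<open>V\<close>.\<close>

lemma X_sum_j:
  assumes x: "x \<noteq> 0" "norm (x * y) < 1"
  shows "P (x * y) * (\<Sum>s. X x (j - int s) s) =
     - q * P (A * q) * P (1 / A) * P (q * y) * V x (j + 1)"
proof -
  define Q where "Q = q powi j"
  have Q: "Q \<noteq> 0" using q_nz by (simp add: Q_def)
  have Q2: "q powi (2 * j) = Q * Q" "q powi (1 - j) = q / Q" "q powi (1 - 2 * j) = q / (Q * Q)"
    "q powi (1 - (j + 1)) = 1 / Q" "q powi (j + 1) = Q * q"
    using q_nz by (simp_all add: Q_def power_int_mult power2_eq_square power_int_diff power_int_add
        power_int_minus power_int_mult_distrib divide_inverse mult.commute[of 2])
  \<comment> \<open>\<alpha> comes from reversing the lower factorial of Aq with index 2j - s, b'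
    and c' from reversing those of Aq/b and Aq/c; d' is not reversed. The same \<alpha> makes 1 - A
    q^(2j-2s) a multiple of 1 - \<alpha> q^(2s).\<close>
  define \<alpha> b' c' d' where "\<alpha> = 1 / (A * Q * Q)" and "b' = b / (A * Q)" and "c' = c / (A * Q)" and "d' = q / x"
  have nz': "b' \<noteq> 0" "c' \<noteq> 0" "d' \<noteq> 0" using nz x q_nz Q by (auto simp: b'_def c'_def d'_def)
  have z: "\<alpha> * q / (b' * c' * d') = x * y" "\<alpha> * q / (b' * c') = q * y"
      "\<alpha> * q / (b' * d') = x / Q / b" "\<alpha> * q / (c' * d') = x / Q / c"
      "\<alpha> * q / b' = q / Q / b" "\<alpha> * q / c' = q / Q / c" "\<alpha> * q / d' = \<alpha> * x"
    using nz x q_nz Q by (simp_all add: \<alpha>_def b'_def c'_def d'_def y_def field_simps)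
  define Kb where "Kb = (\<lambda>b. q powi tri j * (- b) powi j * P (A * q / b * Q))"
  define Kd where "Kd = q powi tri (2 * j) * (- (A * q / x)) powi (2 * j) * P (A * q * (Q * Q))"
  define k where "k = - A * Q * Q * Kb b * Kb c * Kd * y powi j * (x\<^sup>2 / q) powi j"
  have Xeq: "X x (j - int s) s = k * (vwp_coeff b' c' d' \<alpha> s * (\<alpha> * q / (b' * c' * d')) ^ s)" for s
  proof -
    have B: "hx b 1 (j - int s) * P (A * q / b * q powi (j - int s)) =
        Kb b * fin (b / (A * Q)) s * P (q / Q / b * q ^ s) * (A * q / b\<^sup>2) ^ s" if "b \<noteq> 0" for b
    proof -
      have u: "A * q / b \<noteq> 0" using that nz q_nz by simp
      have e: "q / Q / (A * q / b) = b / (A * Q)" using q_nz that nz by simp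
      show ?thesis
        unfolding hx_P_diff_nat[OF that] prod_diff_eq_fin[OF u] Q2 Q_def [symmetric] Kb_def e
        by (simp add: power_divide power2_eq_square power_mult_distrib)
    qed
    have D: "hx (A * q / x) 1 (2 * j - int s) * P (A * q * q powi (2 * j - int s)) =
        Kd * fin \<alpha> s * P (\<alpha> * x * q ^ s) * x ^ s"
    proof -
      have u: "A * q \<noteq> 0" "A * q / x \<noteq> 0" using nz q_nz x by simp_all
      have e: "q / (Q * Q) / (A * q) = \<alpha>" "1 * (q / (Q * Q)) / (A * q / x) = \<alpha> * x"
        using q_nz nz by (simp_all add: \<alpha>_def)
      have "(A * q) ^ s / (A * q / x) ^ s = x ^ s" using nz q_nz x by (simp flip: power_divide)
      hence f: "C * ((A * q) ^ s * v) / (A * q / x) ^ s = C * v * x ^ s" for C v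
        by (metis (no_types, lifting) mult.commute mult.left_commute times_divide_eq_right)
      show ?thesis
        unfolding hx_P_diff_nat[OF u(2)] prod_diff_eq_fin[OF u(1)] Q2 Kd_def e f
        by (simp only: mult_ac)
    qed
    have vw: "1 - A * q powi (2 * (j - int s)) = - A * Q * Q * (1 - \<alpha> * (q ^ s * q ^ s)) / (q\<^sup>2) ^ s"
    proof -
      have "q powi (2 * (j - int s)) = Q * Q / (q ^ s * q ^ s)"
        using q_nz Q2(1) by (simp add: right_diff_distrib power_int_diff power_int_mult power2_eq_square power_mult_distrib)
      thus ?thesis using q_nz nz Q
        by (simp add: \<alpha>_def field_simps power2_eq_square power_mult_distrib)
    qed
    have ys: "y powi (j - int s) = y powi j / y ^ s" using y_nz by (simp add: power_int_diff)
    have "(A * q / b\<^sup>2) ^ s * (A * q / c\<^sup>2) ^ s * x ^ s / (q\<^sup>2) ^ s / y ^ s = (x * y) ^ s"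
    proof -
      have "A * q / b\<^sup>2 * (A * q / c\<^sup>2) * x / q\<^sup>2 / y = x * y"
        using nz q_nz by (simp add: y_def field_simps power2_eq_square)
      thus ?thesis by (simp flip: power_mult_distrib power_divide)
    qed
    note w = this
    have idx: "2 * (j - int s) + int s = 2 * j - int s" "j - int s + int s = j" by simp_all
    show ?thesis
      unfolding X_def base_def idx D B[OF nz(2)] B[OF nz(3)] vw ys vwp_coeff_def z w [symmetric]
      unfolding k_def d'_def [symmetric] b'_def [symmetric] c'_def [symmetric]
      by (simp add: mult_ac)
  qed
  have "(\<Sum>s. X x (j - int s) s) = k * (\<Sum>s. vwp_coeff b' c' d' \<alpha> s * (\<alpha> * q / (b' * c' * d')) ^ s)"
    unfolding Xeq
  proof (rule suminf_mult)
    obtain K where "\<And>\<alpha>' s. norm \<alpha>' \<le> norm \<alpha> \<Longrightarrow> norm (vwp_coeff b' c' d' \<alpha>' s) \<le> K"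
      using vwp_coeff_bounded by blast
    thus "summable (\<lambda>s. vwp_coeff b' c' d' \<alpha> s * (\<alpha> * q / (b' * c' * d')) ^ s)"
      using x z by (intro summable_bounded_geometric) auto
  qed
  hence "P (x * y) * (\<Sum>s. X x (j - int s) s) = k * (P \<alpha> * P (q * y) * P (x / Q / b) * P (x / Q / c))"
    using vwp_sum[OF nz', of \<alpha>] x unfolding z by (simp add: mult_ac)
  also have "\<dots> = - q * P (A * q) * P (1 / A) * P (q * y) * V x (j + 1)"
  proof -
    define F where "F = q powi tri (2 * j) * (- (A * q)) powi (2 * j) * P \<alpha> * P (A * q * (Q * Q))"
    \<comment> \<open>The theta function at index 2j: what remains is independent of j and leaves
      the sum as a constant.\<close>
    have F: "F = P (1 / A) * P (A * q)"
    proof -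
      have "1 * (q / (Q * Q)) / (A * q) = \<alpha>" using q_nz nz by (simp add: \<alpha>_def)
      thus ?thesis
        using theta_shift[of "A * q" "2 * j"] nz q_nz unfolding hx_def Q2 F_def by simp
    qed
    have KdF: "Kd * P \<alpha> * (x\<^sup>2 / q) powi j = F / q powi j"
    proof -
      have "(- (A * q / x)) powi (2 * j) = (- (A * q)) powi (2 * j) / (x\<^sup>2) powi j"
        using x by (simp add: power_int_mult power_divide flip: power_int_divide_distrib)
      moreover have "(x\<^sup>2 / q) powi j = (x\<^sup>2) powi j / q powi j" by (rule power_int_divide_distrib)
      ultimately show ?thesis using x by (simp add: Kd_def F_def)
    qed
    have hxj: "hx b x (j + 1) * P (A / b * (Q * q)) = - b * Q * Kb b * P (x / Q / b)" if "b \<noteq> 0" for b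
    proof -
      have "hx b x (j + 1) = q powi tri j * Q * ((- b) powi j * (- b)) * P (x / Q / b)"
        unfolding hx_def tri_Suc Q2 using that q_nz by (simp add: power_int_add Q_def)
      moreover have "A / b * (Q * q) = A * q / b * Q" by simp
      ultimately show ?thesis unfolding Kb_def by (simp add: mult_ac)
    qed
    have yj: "(y / q) powi (j + 1) = y powi j * y / (q powi j * q)"
      using y_nz q_nz by (simp add: power_int_add power_int_divide_distrib)
    have bcy: "b * c * y = A" using nz by (simp add: y_def)
    have "- q * P (A * q) * P (1 / A) * P (q * y) * V x (j + 1) =
       - q * F * P (q * y) * ((- b * Q * Kb b * P (x / Q / b)) * (- c * Q * Kb c * P (x / Q / c)) * (y powi j * y / (q powi j * q)))"
      unfolding V_def Q2 hxj[OF nz(2)] hxj[OF nz(3)] yj F by (simp add: mult_ac)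
    also have "\<dots> = - (b * c * y) * Q * Q * Kb b * Kb c * (F / q powi j) * y powi j * P (q * y) * P (x / Q / b) * P (x / Q / c)"
      using q_nz by simp
    also have "\<dots> = k * (P \<alpha> * P (q * y) * P (x / Q / b) * P (x / Q / c))"
      unfolding KdF [symmetric] bcy k_def by (simp add: mult_ac)
    finally show ?thesis by simp
  qed
  finally show ?thesis .
qed

end

section \<open>Absolute convergence of the double series\<close>

lemma geo_powi: "a \<noteq> 0 \<Longrightarrow> geo a (1 / a) n = a powi n"
  by (simp add: geo_def power_int_def field_simps)

text \<open>Decouples r from s, with t = |x| and p = |q|. Of the power (t^2/p)^s, a part t^s pays
  for the mixed index 2r + s, and (t/p)^s is left over. This ratio is what confines the double
  series to |x| < |q|.\<close>

lemma geo_shift_le: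
  assumes "0 < t" "t < p" "p < 1"
  shows "geo 1 t (2 * r + int s) * geo (t\<^sup>2 / p) (1 / (t\<^sup>2 / p)) (r + int s) \<le> geo (t\<^sup>2 / p) p r * (t / p) ^ s"
proof -
  define a where "a = t\<^sup>2 / p"
  have a: "a > 0" using assms by (simp add: a_def)
  have geo_a: "geo a (1 / a) (r + int s) = a powi r * a ^ s"
    using a by (simp add: geo_powi power_int_add)
  have a_eq: "a ^ s = (t / p) ^ s * t ^ s"
    by (simp add: a_def power2_eq_square power_divide power_mult_distrib)
  show ?thesis
  proof (cases r rule: int_cases)
    case (nonneg k)
    have "2 * r + int s \<ge> 0" using nonneg by simp
    hence "geo 1 t (2 * r + int s) * geo a (1 / a) (r + int s) = a ^ k * (t / p) ^ s * t ^ s"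
      unfolding geo_a a_eq by (simp add: nonneg geo_def)
    also have "\<dots> \<le> a ^ k * (t / p) ^ s * 1"
      using assms a by (intro mult_left_mono power_le_one) auto
    finally show ?thesis by (simp add: nonneg geo_def a_def)
  next
    case (neg k')
    define k where "k = Suc k'"
    have r: "r = - int k" by (simp add: neg k_def)
    have "a powi r = p ^ k / t ^ (2 * k)"
      using assms by (simp add: r power_int_minus a_def power_divide flip: power_mult)
    hence eq: "geo 1 t (2 * r + int s) * geo a (1 / a) (r + int s) =
        p ^ k * (t / p) ^ s * (geo 1 t (2 * r + int s) * t ^ s / t ^ (2 * k))"
      unfolding geo_a a_eq by simp
    \<comment> \<open>The required t^(2k) comes from t^s alone if s >= 2k; otherwise the decay of
      \<open>geo\<close> at the negative index s - 2k supplies the missing power.\<close>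
    have "geo 1 t (2 * r + int s) * t ^ s \<le> t ^ (2 * k)"
    proof (cases "2 * k \<le> s")
      case True
      hence "geo 1 t (2 * r + int s) = 1" by (simp add: r geo_def)
      thus ?thesis using assms True by (simp add: power_decreasing)
    next
      case False
      hence "nat (- (2 * r + int s)) = 2 * k - s" "\<not> 2 * r + int s \<ge> 0" by (auto simp: r)
      hence "geo 1 t (2 * r + int s) = t ^ (2 * k - s)" unfolding geo_def by simp
      thus ?thesis using False by (simp flip: power_add)
    qed
    hence "geo 1 t (2 * r + int s) * t ^ s / t ^ (2 * k) \<le> 1"
      using assms by simp
    hence "p ^ k * (t / p) ^ s * (geo 1 t (2 * r + int s) * t ^ s / t ^ (2 * k)) \<le> p ^ k * (t / p) ^ s * 1"
      using assms by (intro mult_left_mono) auto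
    moreover have "geo a p r = p ^ k" by (simp add: r geo_def k_def nat_add_distrib)
    ultimately show ?thesis using eq by (simp add: a_def)
  qed
qed

context core begin

lemma norm_X_le:
  assumes x: "x \<noteq> 0" "norm x < norm q"
  obtains C where "\<And>r s. norm (X x r s) \<le> C * (geo (norm (y * x\<^sup>2 / q)) (norm (q * y)) r * norm (x / q) ^ s)"
proof -
  have "geo_bounded {0} (\<lambda>_ r. base r * y powi r) (1 * norm y) (norm y ^ 2 * (1 / norm y))"
    by (intro geo_bounded_mult base_bounded geo_bounded_powi)
  then obtain C1 where C1: "\<And>r. norm (base r * y powi r) \<le> C1 * geo (norm y) (norm y) r"
    unfolding geo_bounded_def using y_nz by (auto simp: power2_eq_square)
  have "geo_bounded {0} (\<lambda>_ n. hx (A * q / x) 1 n * P (A * q * q powi n)) 1 (norm (A * q) / norm (A * q / x))"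
    by (rule hx_P_bounded) (use x nz q_nz in auto)
  moreover have "norm (A * q) / norm (A * q / x) = norm x"
    using nz q_nz x by (simp add: norm_mult norm_divide)
  ultimately obtain C2 where C2: "\<And>n. norm (hx (A * q / x) 1 n * P (A * q * q powi n)) \<le> C2 * geo 1 (norm x) n"
    unfolding geo_bounded_def by auto
  define C3 where "C3 = E (norm (q / x)) * (E (norm q) / norm (P q))"
  have C3: "norm (fin (q / x) s * (1 / fin q s)) \<le> C3" for s
    unfolding C3_def by (intro bounded_coeffs norm_qpoch_le norm_inverse_fin_q_le)
  have mm: "a * b \<le> a' * b'" if "a \<le> a'" "b \<le> b'" "0 \<le> a" "0 \<le> b" for a b a' b' :: real
    using that by (intro mult_mono) auto
  have "norm (X x r s) \<le> (C1 * C3 * C2) * (geo (norm (y * x\<^sup>2 / q)) (norm (q * y)) r * norm (x / q) ^ s)" for r s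
  proof -
    have nonneg: "0 \<le> C1 * C3 * C2 * geo (norm y) (norm y) r"
    proof -
      have "0 \<le> C2" using order_trans[OF norm_ge_zero C2[of 0]] by (simp add: geo_def)
      moreover have "0 \<le> C3" using order_trans[OF norm_ge_zero C3] .
      moreover have "0 \<le> C1 * geo (norm y) (norm y) r" using order_trans[OF norm_ge_zero C1] .
      ultimately show ?thesis by (metis mult.assoc mult.commute mult_nonneg_nonneg)
    qed
    have "norm (X x r s) \<le> C1 * geo (norm y) (norm y) r * C3 * (C2 * geo 1 (norm x) (2 * r + int s)) *
        geo (norm x ^ 2 / norm q) (1 / (norm x ^ 2 / norm q)) (r + int s)"
      unfolding X_def norm_mult[of "base r * y powi r * _ * _"] norm_mult[of "base r * y powi r * _" "hx _ _ _ * _"]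
        norm_mult[of "base r * y powi r" "fin _ _ * _"]
      by (intro mm C1 C2 C3 mult_nonneg_nonneg norm_ge_zero)
         (simp add: norm_powi_eq_geo norm_divide norm_power)
    also have "\<dots> = C1 * C3 * C2 * geo (norm y) (norm y) r * (geo 1 (norm x) (2 * r + int s) *
        geo (norm x ^ 2 / norm q) (1 / (norm x ^ 2 / norm q)) (r + int s))"
      by (simp only: mult_ac)
    also have "\<dots> \<le> C1 * C3 * C2 * geo (norm y) (norm y) r * (geo (norm x ^ 2 / norm q) (norm q) r * (norm x / norm q) ^ s)"
      using x norm_q by (intro mult_left_mono geo_shift_le nonneg) auto
    also have "\<dots> = (C1 * C3 * C2) * (geo (norm (y * x\<^sup>2 / q)) (norm (q * y)) r * norm (x / q) ^ s)"
    proof -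
      have "geo (norm y) (norm y) r * geo (norm x ^ 2 / norm q) (norm q) r = geo (norm (y * x\<^sup>2 / q)) (norm (q * y)) r"
        unfolding geo_mult by (simp add: norm_mult norm_divide norm_power mult_ac)
      from this [symmetric] show ?thesis unfolding norm_divide[of x q] by (simp only: mult_ac)
    qed
    finally show ?thesis .
  qed
  thus ?thesis using that by blast
qed

lemma X_abs_summable:
  assumes x: "x \<noteq> 0" "norm x < norm q" "norm (y * x\<^sup>2 / q) < 1" "norm (q * y) < 1"
  shows "(\<lambda>(r, s). norm (X x r s)) summable_on UNIV"
proof -
  obtain C where C: "\<And>r s. norm (X x r s) \<le> C * (geo (norm (y * x\<^sup>2 / q)) (norm (q * y)) r * norm (x / q) ^ s)"
    using norm_X_le[OF x(1,2)] by blast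
  define v where "v = norm (x / q)"
  have v: "0 \<le> v" "v < 1" using x q_nz by (simp_all add: v_def norm_divide)
  have "(\<lambda>(r, s). geo (norm (y * x\<^sup>2 / q)) (norm (q * y)) r * v ^ s) summable_on (UNIV \<times> UNIV)"
  proof (rule summable_on_SigmaI)
    show "((\<lambda>s. case (r, s) of (r, s) \<Rightarrow> geo (norm (y * x\<^sup>2 / q)) (norm (q * y)) r * v ^ s) has_sum
       geo (norm (y * x\<^sup>2 / q)) (norm (q * y)) r * (1 / (1 - v))) UNIV" for r
    proof -
      have "((\<lambda>s. v ^ s) has_sum (1 / (1 - v))) UNIV"
        using v by (intro norm_summable_imp_has_sum geometric_sums) (auto simp: norm_power)
      from has_sum_cmult_right[OF this, of "geo (norm (y * x\<^sup>2 / q)) (norm (q * y)) r"]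
      show ?thesis by simp
    qed
    show "(\<lambda>r. geo (norm (y * x\<^sup>2 / q)) (norm (q * y)) r * (1 / (1 - v))) summable_on UNIV"
      by (intro summable_on_cmult_left geo_summable) (use x in auto)
    show "(case (r, s) of (r, s) \<Rightarrow> geo (norm (y * x\<^sup>2 / q)) (norm (q * y)) r * v ^ s) \<ge> 0" for r s
      using v by (auto intro!: mult_nonneg_nonneg geo_nonneg)
  qed
  hence sm: "(\<lambda>z. C * (case z of (r, s) \<Rightarrow> geo (norm (y * x\<^sup>2 / q)) (norm (q * y)) r * v ^ s)) summable_on UNIV"
    unfolding UNIV_Times_UNIV by (rule summable_on_cmult_right)
  have "(\<lambda>z. norm (case z of (r, s) \<Rightarrow> X x r s)) summable_on UNIV"
    by (rule Infinite_Sum.abs_summable_on_comparison_test'[OF sm]) (use C in \<open>auto simp: v_def\<close>)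
  thus ?thesis by (simp add: case_prod_unfold)
qed

section \<open>Exchange of summation and continuation in x\<close>

lemma infsum_nat_eq_suminf:
  fixes f :: "nat \<Rightarrow> complex"
  assumes "(\<lambda>s. norm (f s)) summable_on UNIV"
  shows "infsum f UNIV = suminf f"
proof -
  have "summable (\<lambda>s. norm (f s))"
    using assms by (simp add: summable_on_UNIV_nonneg_real_iff)
  thus ?thesis
    by - (rule infsumI[OF norm_summable_imp_has_sum[OF _ summable_sums[OF summable_norm_cancel]]])
qed

lemma core_small:
  assumes x: "x \<noteq> 0" "norm x < norm q" "norm (y * x\<^sup>2 / q) < 1" "norm (q * y) < 1"
  shows "P x * P (x * y) * infsum (W x) UNIV =
    - q * P (x\<^sup>2 / q) * P (A * q) * P (1 / A) * P (q * y) * infsum (V x) UNIV"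
proof -
  define f where "f = (\<lambda>(r, s). X x r s)"
  define g where "g = (\<lambda>(j, s). X x (j - int s) s)"
  have f_abs: "(\<lambda>z. norm (f z)) summable_on UNIV"
    using X_abs_summable[OF x] by (simp add: f_def case_prod_unfold)
  \<comment> \<open>A shear is a bijection here because r runs over all integers: collecting along r
    + s imposes no boundary on s.\<close>
  define h where "h = (\<lambda>(j, s). (j - int s, s))"
  have bij: "bij h"
    by (rule bij_betw_byWitness[where f' = "\<lambda>(r, s). (r + int s, s)"]) (auto simp: h_def)
  have gf: "g = (\<lambda>z. f (h z))" by (auto simp: g_def f_def h_def)
  have g_abs: "(\<lambda>z. norm (g z)) summable_on UNIV"
    using f_abs summable_on_reindex_bij_betw[OF bij, of "\<lambda>z. norm (f z)"] unfolding gf by simp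
  have f_sum: "f summable_on UNIV" and g_sum: "g summable_on UNIV"
    using f_abs g_abs abs_summable_summable by blast+
  have row: "(\<lambda>s. norm (F (r, s))) summable_on UNIV" if "(\<lambda>z. norm (F z)) summable_on UNIV"
    for F :: "int \<times> nat \<Rightarrow> complex" and r
  proof -
    have "(\<lambda>z. norm (F z)) summable_on range (\<lambda>s. (r, s))"
      by (rule summable_on_subset_banach[OF that]) auto
    thus ?thesis by (subst (asm) summable_on_reindex) (auto simp: o_def inj_on_def)
  qed
  have iter: "infsum F UNIV = (\<Sum>\<^sub>\<infinity>r. \<Sum>s. F (r, s))" if "(\<lambda>z. norm (F z)) summable_on UNIV"
    for F :: "int \<times> nat \<Rightarrow> complex"
  proof -
    have "(\<Sum>\<^sub>\<infinity>r. \<Sum>\<^sub>\<infinity>s. F (r, s)) = infsum F (UNIV \<times> UNIV)"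
      using infsum_Sigma'_banach[of "\<lambda>r s. F (r, s)" UNIV "\<lambda>_. UNIV"] abs_summable_summable[OF that]
      by simp
    moreover have "(\<Sum>\<^sub>\<infinity>s. F (r, s)) = (\<Sum>s. F (r, s))" for r
      by (rule infsum_nat_eq_suminf[OF row[OF that]])
    ultimately show ?thesis by simp
  qed
  have fg: "infsum f UNIV = infsum g UNIV"
    unfolding gf using infsum_reindex_bij_betw[OF bij, of f] by simp
  have q2: "norm (x\<^sup>2 / q) < 1"
  proof -
    have "norm x * norm x < 1 * norm q"
      using x norm_q by (intro mult_strict_mono) auto
    thus ?thesis using q_nz by (simp add: norm_divide power2_eq_square norm_mult)
  qed
  have xy: "norm (x * y) < 1"
  proof -
    have "norm (x * y) \<le> norm (q * y)" using x by (simp add: norm_mult mult_right_mono)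
    thus ?thesis using x by linarith
  qed
  have 1: "P (x\<^sup>2 / q) * infsum f UNIV = P x * infsum (W x) UNIV"
    unfolding iter[OF f_abs] by (simp add: f_def X_sum_s[OF x(1) q2] flip: infsum_cmult_right')
  have 2: "P (x * y) * infsum g UNIV = - q * P (A * q) * P (1 / A) * P (q * y) * infsum (V x) UNIV"
  proof -
    have "P (x * y) * infsum g UNIV = (\<Sum>\<^sub>\<infinity>j. - q * P (A * q) * P (1 / A) * P (q * y) * V x (j + 1))"
      unfolding iter[OF g_abs] by (simp add: g_def X_sum_j[OF x(1) xy] flip: infsum_cmult_right')
    also have "\<dots> = - q * P (A * q) * P (1 / A) * P (q * y) * (\<Sum>\<^sub>\<infinity>j. V x (j + 1))"
      by (rule infsum_cmult_right')
    also have "(\<Sum>\<^sub>\<infinity>j. V x (j + 1)) = infsum (V x) UNIV"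
    proof (rule infsum_reindex_bij_betw)
      show "bij (\<lambda>j::int. j + 1)"
        by (rule bij_betw_byWitness[where f' = "\<lambda>j. j - 1"]) auto
    qed
    finally show ?thesis .
  qed
  have "P x * P (x * y) * infsum (W x) UNIV = P (x * y) * (P (x\<^sup>2 / q) * infsum f UNIV)"
    unfolding 1 by simp
  also have "\<dots> = P (x\<^sup>2 / q) * (P (x * y) * infsum g UNIV)"
    unfolding fg by simp
  finally show ?thesis unfolding 2 by (simp add: mult_ac)
qed

lemma core_identity:
  assumes x: "norm (y * x\<^sup>2 / q) < 1" "norm (q * y) < 1"
  shows "P x * P (x * y) * infsum (W x) UNIV =
    - q * P (x\<^sup>2 / q) * P (A * q) * P (1 / A) * P (q * y) * infsum (V x) UNIV"
proof -
  have eq: "norm (y * w\<^sup>2 / q) = norm w ^ 2 * norm (y / q)" for w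
    by (simp add: norm_mult norm_divide norm_power)
  \<comment> \<open>A radius slightly beyond |x| makes x an interior point of a disc on whose
    closure the geometric bounds still hold.\<close>
  obtain \<rho> where \<rho>: "norm x < \<rho>" "\<rho>\<^sup>2 * norm (y / q) < 1"
  proof -
    have "((\<lambda>\<rho>. \<rho>\<^sup>2 * norm (y / q)) \<longlongrightarrow> norm x ^ 2 * norm (y / q)) (at_right (norm x))"
      by (intro tendsto_intros)
    hence "\<forall>\<^sub>F \<rho> in at_right (norm x). \<rho>\<^sup>2 * norm (y / q) < 1"
      using x(1) unfolding eq by (rule order_tendstoD)
    moreover have "\<forall>\<^sub>F \<rho> in at_right (norm x). norm x < \<rho>"
      by (rule eventually_at_right_less)
    ultimately have "\<forall>\<^sub>F \<rho> in at_right (norm x). norm x < \<rho> \<and> \<rho>\<^sup>2 * norm (y / q) < 1"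
      by eventually_elim auto
    thus ?thesis using that eventually_happens'[OF trivial_limit_at_right_real] by blast
  qed
  have \<rho>_pos: "\<rho> > 0" using \<rho>(1) norm_ge_zero[of x] by linarith
  \<comment> \<open>|q| limits the exchange of summation, and the origin is removed from this disc
    because the double series contains q/x.\<close>
  define \<epsilon> where "\<epsilon> = min (norm q) \<rho>"
  have \<epsilon>: "\<epsilon> > 0" using q_nz \<rho>_pos by (simp add: \<epsilon>_def)
  show ?thesis
  proof (rule analytic_continuation_open[where s = "ball 0 \<epsilon> - {0}" and s' = "ball 0 \<rho>" and z = x
        and f = "\<lambda>x. P x * P (x * y) * infsum (W x) UNIV"
        and g = "\<lambda>x. - q * P (x\<^sup>2 / q) * P (A * q) * P (1 / A) * P (q * y) * infsum (V x) UNIV"])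
    show "open (ball (0::complex) \<epsilon> - {0})" "open (ball (0::complex) \<rho>)" "connected (ball (0::complex) \<rho>)"
      by auto
    have "complex_of_real (\<epsilon> / 2) \<in> ball 0 \<epsilon> - {0}" using \<epsilon> by (simp add: norm_divide)
    thus "ball (0::complex) \<epsilon> - {0} \<noteq> {}" by blast
    show "ball 0 \<epsilon> - {0} \<subseteq> ball (0::complex) \<rho>" by (auto simp: \<epsilon>_def)
    show "x \<in> ball 0 \<rho>" using \<rho> by simp
    have "(\<lambda>x. infsum (W x) UNIV) holomorphic_on ball 0 \<rho>"
      by (rule geo_bounded_holomorphic[OF W_bounded[OF \<rho>_pos]])
         (use \<rho> nz q_nz in \<open>auto simp: W_def intro!: holomorphic_intros\<close>)
    thus "(\<lambda>x. P x * P (x * y) * infsum (W x) UNIV) holomorphic_on ball 0 \<rho>"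
      by (intro holomorphic_intros)
    have "(\<lambda>x. infsum (V x) UNIV) holomorphic_on ball 0 \<rho>"
      by (rule geo_bounded_holomorphic[OF V_bounded[OF \<rho>_pos]])
         (use \<rho> x nz q_nz in \<open>auto simp: V_def intro!: holomorphic_intros\<close>)
    thus "(\<lambda>x. - q * P (x\<^sup>2 / q) * P (A * q) * P (1 / A) * P (q * y) * infsum (V x) UNIV) holomorphic_on ball 0 \<rho>"
      using q_nz by (intro holomorphic_intros) auto
    fix w :: complex assume w: "w \<in> ball 0 \<epsilon> - {0}"
    have "norm (y * w\<^sup>2 / q) < 1"
    proof -
      have "norm w ^ 2 * norm (y / q) \<le> \<rho>\<^sup>2 * norm (y / q)"
        using w by (intro mult_right_mono power_mono) (auto simp: \<epsilon>_def)
      thus ?thesis using \<rho> unfolding eq by linarith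
    qed
    thus "P w * P (w * y) * infsum (W w) UNIV =
      - q * P (w\<^sup>2 / q) * P (A * q) * P (1 / A) * P (q * y) * infsum (V w) UNIV"
      using w x by (intro core_small) (auto simp: \<epsilon>_def)
  qed
qed

end

lemma powi_double: "(w :: complex) powi (2 * n) = (w powi n)\<^sup>2"
proof -
  have "w powi (n * 2) = (w powi n) powi 2" by (rule power_int_mult)
  thus ?thesis by (simp only: mult.commute[of n 2] power_int_numeral)
qed

context q_base begin

subsection \<open>Terms of the bilateral series\<close>

text \<open>Valid also for r = q^i with i >= 1 and k <= -i: both sides are 0, the left one by the
  convention 1/0 = 0.\<close>

lemma inverse_qpoch:
  assumes "P r \<noteq> 0"
  shows "inverse (qpoch r q k) = P (r * q powi k) / P r"
proof (cases k rule: int_cases)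
  case (nonneg n)
  thus ?thesis
    using assms P_split[of r n] by (auto simp: qpoch_def field_simps)
next
  case (neg n)
  have "(\<Prod>i=1..m. 1 - r / q ^ i) * P r = P (r / q ^ m)" for m
  proof (induction m)
    case (Suc m)
    have "P (r / q ^ Suc m) = (1 - r / q ^ Suc m) * P (r / q ^ m)"
      using P_step[of "r / q ^ Suc m"] q_nz by simp
    thus ?case using Suc.IH by simp
  qed simp
  from this[of "Suc n"] show ?thesis
    using assms by (simp add: neg qpoch_def power_int_def nat_add_distrib field_simps del: prod.cl_ivl_Suc)
qed

text \<open>The assumption on \<open>P (q / p)\<close> says that p is no power q^i with i >= 1,
  which is exactly the absence of zero denominators at negative k.\<close>

lemma qpoch_eq_hx:
  assumes "p \<noteq> 0" "P (q / p) \<noteq> 0"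
  shows "qpoch p q k = hx p 1 k / P (q / p)"
proof (cases k rule: int_cases)
  case (nonneg n)
  thus ?thesis
    using assms hx_add_nat[of p 1 0 n] by (simp add: qpoch_def hx_0)
next
  case (neg n)
  have "hx p 1 (- int m) * (\<Prod>i=1..m. 1 - p / q ^ i) = P (q / p)" for m
  proof (induction m)
    case (Suc m)
    have "hx p 1 (- int m) = hx p 1 (- int (Suc m)) * (1 - p / q ^ Suc m)"
      using hx_step[OF assms(1), of 1 "- int (Suc m)"]
      by (simp add: power_int_def nat_add_distrib field_simps)
    thus ?case using Suc.IH by (simp add: mult_ac)
  qed (simp add: hx_0)
  from this[of "Suc n"] have *: "hx p 1 k * (\<Prod>i=1..Suc n. 1 - p / q ^ i) = P (q / p)"
    using neg by simp
  hence "(\<Prod>i=1..Suc n. 1 - p / q ^ i) \<noteq> 0" using assms(2) by (metis mult_zero_right)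
  hence "hx p 1 k / P (q / p) = 1 / (\<Prod>i=1..Suc n. 1 - p / q ^ i)"
    using * assms(2) by (simp add: field_simps del: prod.cl_ivl_Suc)
  moreover have "nat (- k) = Suc n" "\<not> k \<ge> 0" using neg by auto
  ultimately show ?thesis by (simp add: qpoch_def del: prod.cl_ivl_Suc)
qed

lemma psi_term_eq:
  assumes "psi_denoms_nonzero as bs q" "0 \<notin> set as"
  shows "psi_term as bs q z k = prod_list (map (\<lambda>p. hx p 1 k / P (q / p)) as) *
    prod_list (map (\<lambda>r. P (r * q powi k) / P r) bs) * z powi k"
    and "p \<in> set as \<Longrightarrow> P (q / p) \<noteq> 0" and "r \<in> set bs \<Longrightarrow> P r \<noteq> 0"
proof -
  have up: "P (q / p) \<noteq> 0" if "p \<in> set as" for p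
  proof
    assume "P (q / p) = 0"
    then obtain i where i: "q / p * q ^ i = 1" by (auto simp: P_eq_0_iff)
    hence "p = q ^ Suc i" by (auto simp: field_simps split: if_splits)
    hence "1 - p / q ^ Suc i = 0" using q_nz by simp
    moreover have "1 - p / q ^ Suc i \<noteq> 0"
      using assms(1) that unfolding psi_denoms_nonzero_def by (metis le_add1 plus_1_eq_Suc)
    ultimately show False by contradiction
  qed
  have lo: "P r \<noteq> 0" if "r \<in> set bs" for r
    using assms(1) that unfolding psi_denoms_nonzero_def P_eq_0_iff by (metis right_minus_eq)
  show "p \<in> set as \<Longrightarrow> P (q / p) \<noteq> 0" "r \<in> set bs \<Longrightarrow> P r \<noteq> 0" using up lo by auto
  have "qpochs as q k = prod_list (map (\<lambda>p. hx p 1 k / P (q / p)) as)"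
    unfolding qpochs_def
    by (rule arg_cong[where f = prod_list], rule map_cong) (use up assms(2) in \<open>auto intro!: qpoch_eq_hx\<close>)
  moreover have "inverse (qpochs bs q k) = prod_list (map (\<lambda>r. P (r * q powi k) / P r) bs)"
    using lo unfolding qpochs_def by (induction bs) (auto simp: inverse_qpoch)
  ultimately show "psi_term as bs q z k = prod_list (map (\<lambda>p. hx p 1 k / P (q / p)) as) *
    prod_list (map (\<lambda>r. P (r * q powi k) / P r) bs) * z powi k"
    unfolding psi_term_def by (simp add: divide_inverse)
qed

text \<open>This is (qs)_k / (s)_k; the theta function at qs eliminates \<open>hx\<close>, leaving a
  quotient of two single factors.\<close>

lemma vwp_pair:
  assumes "s \<noteq> 0" "P (1 / s) \<noteq> 0" "P s \<noteq> 0"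
  shows "hx (q * s) 1 k / P (1 / s) * (P (s * q powi k) / P s) = (1 - s * q powi k) / (1 - s)"
proof -
  have "P (s * q powi k) = (1 - s * q powi k) * P (q * s * q powi k)"
    using P_step[of "s * q powi k"] by (simp add: mult_ac)
  hence "hx (q * s) 1 k * P (s * q powi k) = (1 - s * q powi k) * (P (1 / s) * P (s * q))"
    using theta_shift[of "q * s" k] assms(1) q_nz by (simp add: mult_ac)
  moreover have "P s = (1 - s) * P (s * q)" by (rule P_step)
  hence "P (s * q) \<noteq> 0" "1 - s \<noteq> 0" using assms(3) by auto
  ultimately show ?thesis using assms(2) P_step[of s] by (simp add: times_divide_times_eq)
qed

text \<open>(s, -s)_inf collects the factors of (s^2)_inf with even exponent and (t, -t)_inf those
  with odd exponent. Only squares enter, so s and t may be any branches.\<close>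

lemma P_quadruple:
  assumes "t\<^sup>2 = s\<^sup>2 * q"
  shows "P s * P (- s) * (P t * P (- t)) = P (s\<^sup>2)"
proof (rule LIMSEQ_unique)
  show "(\<lambda>n. fin s n * fin (- s) n * (fin t n * fin (- t) n)) \<longlonglongrightarrow> P s * P (- s) * (P t * P (- t))"
    by (intro tendsto_mult P_LIMSEQ)
  have "fin s n * fin (- s) n * (fin t n * fin (- t) n) = fin (s\<^sup>2) (2 * n)" for n
  proof (induction n)
    case (Suc n)
    have s: "(1 - s * q ^ n) * (1 - - s * q ^ n) = 1 - s\<^sup>2 * q ^ (2 * n)"
      by (simp add: power_mult algebra_simps power2_eq_square power_mult_distrib)
    have "(1 - t * q ^ n) * (1 - - t * q ^ n) = 1 - t\<^sup>2 * q ^ (2 * n)"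
      by (simp add: power_mult algebra_simps power2_eq_square power_mult_distrib)
    hence t: "(1 - t * q ^ n) * (1 - - t * q ^ n) = 1 - s\<^sup>2 * q ^ Suc (2 * n)"
      by (simp add: assms)
    have "fin s (Suc n) * fin (- s) (Suc n) * (fin t (Suc n) * fin (- t) (Suc n)) =
      (fin s n * fin (- s) n * (fin t n * fin (- t) n)) *
      ((1 - s * q ^ n) * (1 - - s * q ^ n)) * ((1 - t * q ^ n) * (1 - - t * q ^ n))"
      unfolding prod.lessThan_Suc by (simp only: mult_ac)
    also have "\<dots> = fin (s\<^sup>2) (2 * Suc n)"
      unfolding Suc.IH s t by (simp add: mult_ac)
    finally show ?case .
  qed simp
  moreover have "(\<lambda>n. fin (s\<^sup>2) (2 * n)) \<longlonglongrightarrow> P (s\<^sup>2)"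
    by (rule filterlim_compose[OF P_LIMSEQ]) (auto intro: mult_nat_left_at_top)
  ultimately show "(\<lambda>n. fin s n * fin (- s) n * (fin t n * fin (- t) n)) \<longlonglongrightarrow> P (s\<^sup>2)"
    by simp
qed

lemma tri_double: "tri (2 * k) = 4 * tri k + k"
proof -
  have "2 * tri n = n * (n - 1)" for n
    unfolding tri_def by (intro dvd_mult_div_cancel) (cases "even n", auto)
  from this[of "2 * k"] this[of k] show ?thesis by (simp add: algebra_simps)
qed

text \<open>The counterpart with finite index, (t, -t, qs, -qs)_k = (aq)_2k. The reversal exponents
  agree because of \<open>tri_double\<close>.\<close>

lemma hx_quadruple:
  assumes "s\<^sup>2 = a" "t\<^sup>2 = a * q" "a \<noteq> 0"
  shows "hx t 1 k * hx (- t) 1 k * (hx (q * s) 1 k * hx (- (q * s)) 1 k) = hx (a * q) 1 (2 * k)"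
proof -
  define v w where "v = 1 * q powi (1 - k) / t" and "w = 1 * q powi (1 - k) / (q * s)"
  have nz: "s \<noteq> 0" "t \<noteq> 0" using assms q_nz by auto
  have "v\<^sup>2 = (q powi (1 - k))\<^sup>2 / (a * q)" "w\<^sup>2 = (q powi (1 - k))\<^sup>2 / (q\<^sup>2 * a)"
    using assms by (simp_all add: v_def w_def power_divide power_mult_distrib)
  hence vw: "v\<^sup>2 = w\<^sup>2 * q" using q_nz by (simp add: power2_eq_square)
  have "(q powi (1 - k))\<^sup>2 = q * q powi (1 - 2 * k)"
  proof -
    have "(q powi (1 - k))\<^sup>2 = q powi ((1 - k) + (1 - k))"
      using q_nz by (subst power_int_add) (auto simp: power2_eq_square)
    also have "(1 - k) + (1 - k) = 1 + (1 - 2 * k)" by simp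
    also have "q powi \<dots> = q * q powi (1 - 2 * k)"
      using q_nz by (subst power_int_add) auto
    finally show ?thesis .
  qed
  hence w2: "w\<^sup>2 = 1 * q powi (1 - 2 * k) / (a * q)"
    using \<open>w\<^sup>2 = _\<close> q_nz by (simp add: power2_eq_square)
  have neg: "1 * q powi (1 - k) / - t = - v" "1 * q powi (1 - k) / - (q * s) = - w"
    by (simp_all add: v_def w_def)
  have "hx t 1 k * hx (- t) 1 k * (hx (q * s) 1 k * hx (- (q * s)) 1 k) =
    (q powi tri k) ^ 4 * ((- t) powi k * (- (- t)) powi k * ((- (q * s)) powi k * (- (- (q * s))) powi k)) *
    (P w * P (- w) * (P v * P (- v)))"
    unfolding hx_def neg v_def [symmetric] w_def [symmetric] by (simp add: power4_eq_xxxx mult_ac)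
  also have "P w * P (- w) * (P v * P (- v)) = P (1 * q powi (1 - 2 * k) / (a * q))"
    unfolding P_quadruple[OF vw] w2 ..
  also have "(q powi tri k) ^ 4 = q powi (4 * tri k)"
    by (simp add: power_int_mult mult.commute[of 4])
  also have "(- t) powi k * (- (- t)) powi k * ((- (q * s)) powi k * (- (- (q * s))) powi k) =
      q powi k * (- (a * q)) powi (2 * k)"
  proof -
    have "(- t) * (- (- t)) * ((- (q * s)) * (- (- (q * s)))) = q * (- (a * q))\<^sup>2"
    proof -
      have "(- t) * (- (- t)) * ((- (q * s)) * (- (- (q * s)))) = t\<^sup>2 * (q\<^sup>2 * s\<^sup>2)"
        by (simp add: power2_eq_square mult_ac)
      also have "\<dots> = a * q * (q\<^sup>2 * a)" by (simp only: assms)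
      also have "\<dots> = q * (- (a * q))\<^sup>2" by (simp add: power2_eq_square)
      finally show ?thesis .
    qed
    hence "((- t) * (- (- t)) * ((- (q * s)) * (- (- (q * s))))) powi k = (q * (- (a * q))\<^sup>2) powi k" by (simp only:)
    thus ?thesis by (simp only: power_int_mult_distrib power_int_mult power_int_numeral)
  qed
  also have "q powi (4 * tri k) * (q powi k * (- (a * q)) powi (2 * k)) * P (1 * q powi (1 - 2 * k) / (a * q)) =
     hx (a * q) 1 (2 * k)"
    unfolding hx_def tri_double using q_nz by (simp add: power_int_add mult_ac)
  finally show ?thesis .
qed


lemma vwp_double_pair:
  assumes "s \<noteq> 0" "P (q / (q * s)) \<noteq> 0" "P (q / (- q * s)) \<noteq> 0" "P s \<noteq> 0" "P (- s) \<noteq> 0"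
  shows "hx (q * s) 1 k / P (q / (q * s)) * (hx (- q * s) 1 k / P (q / (- q * s))) *
    (P (s * q powi k) / P s * (P (- s * q powi k) / P (- s))) = (1 - s\<^sup>2 * q powi (2 * k)) / (1 - s\<^sup>2)"
proof -
  have e: "q / (q * s) = 1 / s" "q / (- q * s) = 1 / - s" "- q * s = q * - s" using q_nz by simp_all
  have nz: "P (1 / s) \<noteq> 0" "P (1 / - s) \<noteq> 0" using assms(2,3) unfolding e(1,2) by simp_all
  have "hx (q * s) 1 k / P (1 / s) * (P (s * q powi k) / P s) *
      (hx (q * - s) 1 k / P (1 / - s) * (P (- s * q powi k) / P (- s))) =
      (1 - s * q powi k) / (1 - s) * ((1 - - s * q powi k) / (1 - - s))"
    using assms(1,4,5) nz by (intro arg_cong2[where f = "(*)"] vwp_pair) simp_all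
  also have "\<dots> = (1 - s\<^sup>2 * q powi (2 * k)) / (1 - s\<^sup>2)"
  proof -
    have "(1 - s * u) * (1 - - s * u) = 1 - s\<^sup>2 * u\<^sup>2" for u
      by (simp add: algebra_simps power2_eq_square)
    from this[of "q powi k"] this[of 1] show ?thesis
      by (simp only: times_divide_times_eq powi_double mult_1_right power_one)
  qed
  finally show ?thesis unfolding e(1,2) unfolding e(3) by (simp only: mult_ac)
qed

lemma psi4_term:
  fixes s b c :: complex
  defines "a \<equiv> s\<^sup>2"
  assumes psi: "psi_denoms_nonzero [q * s, - q * s, b, c] [s, - s, a * q / b, a * q / c] q"
    and nz: "s \<noteq> 0" "b \<noteq> 0" "c \<noteq> 0"
  shows "psi_term [q * s, - q * s, b, c] [s, - s, a * q / b, a * q / c] q z k =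
    (1 - a * q powi (2 * k)) * (hx b 1 k * P (a * q / b * q powi k)) * (hx c 1 k * P (a * q / c * q powi k)) * z powi k /
    ((1 - a) * P (q / b) * P (q / c) * P (a * q / b) * P (a * q / c))"
proof -
  have z: "0 \<notin> set [q * s, - q * s, b, c]" using nz q_nz by auto
  note t = psi_term_eq[OF psi z]
  have P0: "P (q / (q * s)) \<noteq> 0" "P (q / (- q * s)) \<noteq> 0" "P s \<noteq> 0" "P (- s) \<noteq> 0"
    by (rule t(2,3), simp)+
  have "psi_term [q * s, - q * s, b, c] [s, - s, a * q / b, a * q / c] q z k =
     (hx (q * s) 1 k / P (q / (q * s)) * (hx (- q * s) 1 k / P (q / (- q * s))) *
     (P (s * q powi k) / P s * (P (- s * q powi k) / P (- s)))) *
     (hx b 1 k / P (q / b) * (hx c 1 k / P (q / c)) *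
     (P (a * q / b * q powi k) / P (a * q / b) * (P (a * q / c * q powi k) / P (a * q / c)))) * z powi k"
    unfolding t(1) list.map prod_list.Cons prod_list.Nil by (simp only: mult_ac mult_1_right mult_1_left)
  also have "hx (q * s) 1 k / P (q / (q * s)) * (hx (- q * s) 1 k / P (q / (- q * s))) *
     (P (s * q powi k) / P s * (P (- s * q powi k) / P (- s))) = (1 - a * q powi (2 * k)) / (1 - a)"
    unfolding a_def by (rule vwp_double_pair) (rule nz P0)+
  finally show ?thesis by (simp only: divide_inverse inverse_mult_distrib mult_ac)
qed

text \<open>Here \<open>b\<close>, \<open>c\<close> are bx, cx of the theorem, while
  \<open>d\<close>, \<open>e\<close> are left free for aq/b, aq/c with the unscaled b, c. The four
  upper and four lower square-root parameters collapse to factorials of index 2k.\<close>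

lemma psi8_term:
  fixes s t v b c x :: complex
  defines "a \<equiv> s\<^sup>2"
  assumes psi: "psi_denoms_nonzero [q * v, - q * v, t, - t, q * s, - q * s, b, c]
      [v, - v, x * t, - x * t, x * s, - x * s, d, e] q"
    and nz: "s \<noteq> 0" "v \<noteq> 0" "b \<noteq> 0" "c \<noteq> 0"
    and t: "t\<^sup>2 = a * q"
  shows "psi_term [q * v, - q * v, t, - t, q * s, - q * s, b, c]
      [v, - v, x * t, - x * t, x * s, - x * s, d, e] q z k =
    (1 - v\<^sup>2 * q powi (2 * k)) * (hx b 1 k * P (d * q powi k)) * (hx c 1 k * P (e * q powi k)) *
      (hx (a * q) 1 (2 * k) * P (a * x\<^sup>2 * q powi (2 * k))) * z powi k /
    ((1 - v\<^sup>2) * P (1 / a) * P (a * x\<^sup>2) * P (q / b) * P (q / c) * P d * P e)"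
    and "P (1 / a) \<noteq> 0" and "P (a * x\<^sup>2) \<noteq> 0"
proof -
  have t0: "t \<noteq> 0" and a0: "a \<noteq> 0" using t nz q_nz by (auto simp: a_def)
  have z: "0 \<notin> set [q * v, - q * v, t, - t, q * s, - q * s, b, c]" using nz t0 q_nz by auto
  note pt = psi_term_eq[OF psi z]
  have up: "P (q / t) * P (q / - t) * (P (q / (q * s)) * P (q / (- q * s))) = P (1 / a)"
  proof -
    have "(q / t)\<^sup>2 = (1 / s)\<^sup>2 * q"
      using q_nz t by (simp add: power_divide a_def power2_eq_square)
    from P_quadruple[OF this] show ?thesis
      using q_nz by (simp add: a_def power_divide mult_ac)
  qed
  have lo: "P (x * t * q powi n) * P (- x * t * q powi n) * (P (x * s * q powi n) * P (- x * s * q powi n)) =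
      P (a * x\<^sup>2 * q powi (2 * n))" for n
  proof -
    define T S where "T = x * t * q powi n" and "S = x * s * q powi n"
    have "T\<^sup>2 = S\<^sup>2 * q"
      using t by (simp add: T_def S_def power_mult_distrib a_def)
    from P_quadruple[OF this] have "P T * P (- T) * (P S * P (- S)) = P (S\<^sup>2)"
      by (simp only: mult.commute)
    moreover have "S\<^sup>2 = a * x\<^sup>2 * q powi (2 * n)"
      unfolding S_def a_def powi_double power_mult_distrib by (simp only: mult_ac)
    moreover have "- x * t * q powi n = - T" "- x * s * q powi n = - S" by (simp_all add: T_def S_def)
    ultimately show ?thesis unfolding T_def [symmetric] S_def [symmetric] by (simp only:)
  qed
  have "P (q / t) \<noteq> 0" "P (q / - t) \<noteq> 0" "P (q / (q * s)) \<noteq> 0" "P (q / (- q * s)) \<noteq> 0"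
    by (rule pt(2), simp)+
  thus "P (1 / a) \<noteq> 0" unfolding up [symmetric] by (simp only: mult_eq_0_iff simp_thms)
  have lo0: "P (x * t) * P (- x * t) * (P (x * s) * P (- x * s)) = P (a * x\<^sup>2)"
    using lo[of 0] by simp
  have "P (x * t) \<noteq> 0" "P (- x * t) \<noteq> 0" "P (x * s) \<noteq> 0" "P (- x * s) \<noteq> 0"
    by (rule pt(3), simp)+
  thus "P (a * x\<^sup>2) \<noteq> 0" unfolding lo0 [symmetric] by (simp only: mult_eq_0_iff simp_thms)
  have hq: "hx t 1 k * hx (- t) 1 k * (hx (q * s) 1 k * hx (- q * s) 1 k) = hx (a * q) 1 (2 * k)"
    using hx_quadruple[of s a t k] t a0 by (simp add: a_def)
  have P0: "P (q / (q * v)) \<noteq> 0" "P (q / (- q * v)) \<noteq> 0" "P v \<noteq> 0" "P (- v) \<noteq> 0"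
    by (rule pt(2,3), simp)+
  have "psi_term [q * v, - q * v, t, - t, q * s, - q * s, b, c]
      [v, - v, x * t, - x * t, x * s, - x * s, d, e] q z k =
     (hx (q * v) 1 k / P (q / (q * v)) * (hx (- q * v) 1 k / P (q / (- q * v))) *
     (P (v * q powi k) / P v * (P (- v * q powi k) / P (- v)))) *
     ((hx t 1 k * hx (- t) 1 k * (hx (q * s) 1 k * hx (- q * s) 1 k)) /
       (P (q / t) * P (q / - t) * (P (q / (q * s)) * P (q / (- q * s))))) *
     ((P (x * t * q powi k) * P (- x * t * q powi k) * (P (x * s * q powi k) * P (- x * s * q powi k))) /
      (P (x * t) * P (- x * t) * (P (x * s) * P (- x * s)))) *
     (hx b 1 k / P (q / b) * (hx c 1 k / P (q / c)) *
     (P (d * q powi k) / P d * (P (e * q powi k) / P e))) * z powi k"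
    unfolding pt(1) list.map prod_list.Cons prod_list.Nil times_divide_times_eq [symmetric]
    by (simp only: mult_ac mult_1_right mult_1_left)
  also have "hx (q * v) 1 k / P (q / (q * v)) * (hx (- q * v) 1 k / P (q / (- q * v))) *
     (P (v * q powi k) / P v * (P (- v * q powi k) / P (- v))) = (1 - v\<^sup>2 * q powi (2 * k)) / (1 - v\<^sup>2)"
    by (rule vwp_double_pair) (rule nz P0)+
  finally show "psi_term [q * v, - q * v, t, - t, q * s, - q * s, b, c]
      [v, - v, x * t, - x * t, x * s, - x * s, d, e] q z k =
    (1 - v\<^sup>2 * q powi (2 * k)) * (hx b 1 k * P (d * q powi k)) * (hx c 1 k * P (e * q powi k)) *
      (hx (a * q) 1 (2 * k) * P (a * x\<^sup>2 * q powi (2 * k))) * z powi k /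
    ((1 - v\<^sup>2) * P (1 / a) * P (a * x\<^sup>2) * P (q / b) * P (q / c) * P d * P e)"
    unfolding hq up lo lo0
    by (simp only: divide_inverse inverse_mult_distrib mult_ac)
qed

end

context core begin

lemma W_abs_summable:
  assumes "x \<noteq> 0" "norm (y * x\<^sup>2 / q) < 1"
  shows "(\<lambda>k. norm (W x k)) summable_on UNIV"
  using assms geo_bounded_abs_summable[OF W_bounded[of "norm x"], of x]
  by (simp add: norm_mult norm_divide norm_power mult_ac)

lemma V_abs_summable:
  assumes "x \<noteq> 0" "norm (y * x\<^sup>2 / q) < 1" "norm (q * y) < 1"
  shows "(\<lambda>k. norm (V x k)) summable_on UNIV"
  using assms geo_bounded_abs_summable[OF V_bounded[of "norm x"], of x]
  by (simp add: norm_mult norm_divide norm_power mult_ac)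

end

section \<open>The contiguous relation that restores the very-well-poised factor\<close>

context q_base begin

text \<open>With Y = q^k, the two products on the right are what distinguishes the terms k and k + 1
  of the series with lower parameters a/b, a/c, once their common part is removed.\<close>

lemma contiguous_vwp:
  fixes a b c Y :: complex
  assumes "b \<noteq> 0" "c \<noteq> 0"
  shows "(1 - a / (b * c)) * (1 - a * Y\<^sup>2) =
    (1 - a / b * Y) * (1 - a / c * Y) - a / (b * c) * ((1 - b * Y) * (1 - c * Y))"
  using assms by (simp add: field_simps power2_eq_square)

text \<open>Each term is proportional to u k - (g/z) u (k + 1) with g = a/(bc). Both shifts of u
  have the same bilateral sum, so no boundary term appears and 1 - g/z factors out.\<close>

lemma bilateral_vwp_sum:
  fixes a b c z :: complex
  defines "u \<equiv> \<lambda>k. (hx b 1 k * P (a / b * q powi k)) * (hx c 1 k * P (a / c * q powi k)) * z powi k"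
  assumes nz: "b \<noteq> 0" "c \<noteq> 0" "z \<noteq> 0" and u: "u summable_on UNIV" and abc: "a / (b * c) \<noteq> 1"
  shows "((\<lambda>k. (1 - a * q powi (2 * k)) * (hx b 1 k * P (a * q / b * q powi k)) *
      (hx c 1 k * P (a * q / c * q powi k)) * z powi k) has_sum
      ((1 - a / (b * c) / z) / (1 - a / (b * c)) * infsum u UNIV)) UNIV"
proof -
  define g where "g = a / (b * c)"
  have g: "1 - g \<noteq> 0" using abc by (simp add: g_def)
  define F where "F = (\<lambda>k. (1 - a * q powi (2 * k)) * (hx b 1 k * P (a * q / b * q powi k)) *
      (hx c 1 k * P (a * q / c * q powi k)) * z powi k)"
  have eq: "(1 - g) * F k = u k - g / z * u (k + 1)" for k
  proof -
    define Y where "Y = q powi k"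
    define m where "m = hx b 1 k * hx c 1 k * P (a * q / b * Y) * P (a * q / c * Y) * z powi k"
    have st: "P (a / b * Y) = (1 - a / b * Y) * P (a * q / b * Y)" for b
      using P_step[of "a / b * Y"] by (simp add: mult_ac)
    have 1: "u k = (1 - a / b * Y) * (1 - a / c * Y) * m"
      unfolding u_def Y_def [symmetric] st m_def by (simp only: mult_ac)
    have "a / b * (Y * q) = a * q / b * Y" for b by simp
    hence "u (k + 1) = ((hx b 1 k * (1 - b * Y)) * P (a * q / b * Y)) *
        ((hx c 1 k * (1 - c * Y)) * P (a * q / c * Y)) * (z powi k * z)"
      unfolding u_def using nz q_nz by (simp add: hx_step power_int_add Y_def mult_ac)
    hence 2: "u (k + 1) = (1 - b * Y) * (1 - c * Y) * m * z"
      unfolding m_def by (simp only: mult_ac)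
    have "(1 - g) * (1 - a * Y\<^sup>2) * m = u k - g / z * u (k + 1)"
      unfolding g_def contiguous_vwp[OF nz(1,2)] 1 2 using nz by (simp add: algebra_simps)
    thus ?thesis unfolding m_def F_def powi_double Y_def by (simp only: mult_ac)
  qed
  have bij: "bij (\<lambda>k::int. k + 1)"
    by (rule bij_betw_byWitness[where f' = "\<lambda>k. k - 1"]) auto
  have us: "(u has_sum infsum u UNIV) UNIV" using u by simp
  hence "((\<lambda>k. u (k + 1)) has_sum infsum u UNIV) UNIV"
    using has_sum_reindex_bij_betw[OF bij, of u] by simp
  hence "((\<lambda>k. u k - g / z * u (k + 1)) has_sum (infsum u UNIV - g / z * infsum u UNIV)) UNIV"
    using has_sum_add[OF us has_sum_cmult_right[of "\<lambda>k. u (k + 1)" UNIV _ "- (g / z)"]] by simp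
  from has_sum_cmult_right[OF this, of "1 / (1 - g)"]
  have "((\<lambda>k. 1 / (1 - g) * ((1 - g) * F k)) has_sum 1 / (1 - g) * (infsum u UNIV - g / z * infsum u UNIV)) UNIV"
    unfolding eq .
  moreover have "1 / (1 - g) * ((1 - g) * F k) = F k" for k using g by simp
  moreover have "infsum u UNIV - g / z * infsum u UNIV = (1 - g / z) * infsum u UNIV"
    by (simp only: left_diff_distrib mult_1_left)
  hence "1 / (1 - g) * (infsum u UNIV - g / z * infsum u UNIV) = (1 - g / z) / (1 - g) * infsum u UNIV"
    by simp
  ultimately have "(F has_sum ((1 - g / z) / (1 - g) * infsum u UNIV)) UNIV" by (simp only:)
  thus ?thesis unfolding F_def g_def .
qed

end

text \<open>\<open>p1\<close> to \<open>p6\<close> are the numerator products of the theorem in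
  order, with \<open>p5\<close> standing for (x)_inf instead of (x/q)_inf; \<open>d1\<close> to
  \<open>d6\<close> are the denominator products. \<open>e1\<close>, \<open>e2\<close> are
  (aq/b)_inf, (aq/c)_inf, and \<open>g\<close> is a/(bc); \<open>sv\<close>, \<open>sw\<close> are
  the sums of \<open>V\<close> and \<open>W\<close>.\<close>

lemma psi_prefactor_algebra:
  fixes a x q g sv sw :: complex
  assumes "a \<noteq> 0" "x \<noteq> 0" "q \<noteq> 0" "1 - a \<noteq> 0" "1 - a * x \<noteq> 0" "1 - g \<noteq> 0"
    and "p1 \<noteq> 0" "p3 \<noteq> 0" "p4 \<noteq> 0" "p6 \<noteq> 0" "d1 * (d2 * (d3 * (d4 * (d5 * d6)))) \<noteq> 0"
    and core: "p5 * ((1 - g) * p2) * sw = - q * d6 * d5 * ((1 - 1 / (a * x)) * d4) * d3 * sv"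
  shows "(1 - q / x) / (1 - g) * sv * inverse ((1 - a) * d1 * d2 * e1 * e2) =
    p1 * (p2 * (p3 * (p4 * ((1 - x / q) * p5 * p6)))) / (d1 * (d2 * (d3 * (d4 * (d5 * d6))))) *
    (sw / ((1 - a * x) * ((1 - 1 / a) * p1) * p6 * p3 * p4 * e1 * e2))"
proof -
  have d: "d1 \<noteq> 0" "d2 \<noteq> 0" "d3 \<noteq> 0" "d4 \<noteq> 0" "d5 \<noteq> 0" "d6 \<noteq> 0" using assms(11) by auto
  have a1: "1 - 1 / a = - (1 - a) / a" "1 - 1 / (a * x) = - (1 - a * x) / (a * x)"
    "1 - x / q = - (x / q) * (1 - q / x)"
    using assms(1-3) by (simp_all add: field_simps)
  define u where "u = (1 - a * x) / (a * x)"
  have "p5 * ((1 - g) * p2) * sw = q * d6 * d5 * (u * d4) * d3 * sv"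
  proof -
    have "1 - 1 / (a * x) = - u" using a1(2) by (simp add: u_def minus_divide_left)
    thus ?thesis using core by (simp only: mult_minus_left mult_minus_right minus_minus)
  qed
  hence K: "p5 * p2 * sw = q * d6 * d5 * d4 * d3 * sv * u / (1 - g)"
    using assms(6) by (simp add: eq_divide_eq mult_ac)
  have "p1 * (p2 * (p3 * (p4 * ((1 - x / q) * p5 * p6)))) / (d1 * (d2 * (d3 * (d4 * (d5 * d6))))) *
      (sw / ((1 - a * x) * ((1 - 1 / a) * p1) * p6 * p3 * p4 * e1 * e2)) =
    (p5 * p2 * sw) * (1 - x / q) / (d1 * d2 * d3 * d4 * d5 * d6 * (1 - a * x) * (1 - 1 / a) * e1 * e2)"
    using assms(7-10) by (simp add: mult_ac)
  also have "\<dots> = (1 - q / x) / (1 - g) * sv * inverse ((1 - a) * d1 * d2 * e1 * e2)"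
  proof -
    have "q * d6 * d5 * d4 * d3 * sv * (n / (a * x)) / h * (- (x / q) * w) /
        (d1 * d2 * d3 * d4 * d5 * d6 * n * (- m / a) * e1 * e2) = w / h * sv * inverse (m * d1 * d2 * e1 * e2)"
      if "n \<noteq> 0" "m \<noteq> 0" "h \<noteq> 0" for m n h w
      using that assms(1-3) d by (cases "e1 = 0 \<or> e2 = 0") (auto simp: field_simps)
    from this[OF assms(5,4,6)] show ?thesis unfolding K a1(1,3) u_def .
  qed
  finally show ?thesis by simp
qed

section \<open>Both series expressed through the sums of \<open>V\<close> and
  \<open>W\<close>\<close>

theorem theorem2:
  fixes q a b c x sqrt_a sqrt_ax sqrt_aq :: complex
  assumes "norm q < 1"
    and "q \<noteq> 0" "a \<noteq> 0" "b \<noteq> 0" "c \<noteq> 0" "x \<noteq> 0"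
    and "max (norm (a * q / (b * c * x))) (norm (a * x / (b * c * q))) < 1"
    and "sqrt_a ^ 2 = a" "sqrt_ax ^ 2 = a * x" "sqrt_aq ^ 2 = a * q"
    and "psi_denoms_nonzero
           [q * sqrt_a, - q * sqrt_a, b, c]
           [sqrt_a, - sqrt_a, a * q / b, a * q / c] q"
    and "psi_denoms_nonzero
           [q * sqrt_ax, - q * sqrt_ax, sqrt_aq, - sqrt_aq, q * sqrt_a, - q * sqrt_a, b * x, c * x]
           [sqrt_ax, - sqrt_ax, x * sqrt_aq, - x * sqrt_aq, x * sqrt_a, - x * sqrt_a, a * q / b, a * q / c] q"
    and "qpoch_infs [q / b, q / c, a * q / (b * c * x), q / (a * x), a * q * x, x ^ 2 / q] q \<noteq> 0"
  shows "psi_converges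
           [q * sqrt_a, - q * sqrt_a, b, c]
           [sqrt_a, - sqrt_a, a * q / b, a * q / c] q (a * x / (b * c * q)) \<and>
         psi_converges
           [q * sqrt_ax, - q * sqrt_ax, sqrt_aq, - sqrt_aq, q * sqrt_a, - q * sqrt_a, b * x, c * x]
           [sqrt_ax, - sqrt_ax, x * sqrt_aq, - x * sqrt_aq, x * sqrt_a, - x * sqrt_a, a * q / b, a * q / c]
           q (a * x / (b * c * q)) \<and>
         psi [q * sqrt_a, - q * sqrt_a, b, c]
             [sqrt_a, - sqrt_a, a * q / b, a * q / c] q (a * x / (b * c * q)) =
         qpoch_infs [q / a, a * q / (b * c), q / (b * x), q / (c * x), x / q, a * x ^ 2] q /
         qpoch_infs [q / b, q / c, a * q / (b * c * x), q / (a * x), a * q * x, x ^ 2 / q] q *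
         psi [q * sqrt_ax, - q * sqrt_ax, sqrt_aq, - sqrt_aq, q * sqrt_a, - q * sqrt_a, b * x, c * x]
             [sqrt_ax, - sqrt_ax, x * sqrt_aq, - x * sqrt_aq, x * sqrt_a, - x * sqrt_a, a * q / b, a * q / c]
             q (a * x / (b * c * q))"
proof -
  note norm_q = assms(1) and nzs = assms(2-6) and sq = assms(8-10)
    and psi4 = assms(11) and psi8 = assms(12) and den = assms(13)
  interpret q_base q by unfold_locales (use norm_q nzs in auto)
  interpret core q "a * x" "b * x" "c * x" by unfold_locales (use nzs in auto)
  let ?z = "a * x / (b * c * q)"
  have y_eq: "y = a / (b * c * x)" using nzs by (simp add: y_def)
  have s_nz: "sqrt_a \<noteq> 0" "sqrt_ax \<noteq> 0" using sq nzs by auto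
  have qy: "q * y = a * q / (b * c * x)" and yx: "y * x\<^sup>2 / q = ?z" "x\<^sup>2 * (y / q) = ?z"
    using nzs by (simp_all add: y_eq power2_eq_square mult_ac)
  have small: "norm (q * y) < 1" "norm (y * x\<^sup>2 / q) < 1"
    using assms(7) unfolding qy yx by simp_all
  \<comment> \<open>The two quantities bounded in the hypothesis multiply to (a/(bc))^2. This
    permits the division by 1 - a/(bc) in the contiguous relation.\<close>
  have abc_small: "norm (a / (b * c)) < 1"
  proof -
    have "(a / (b * c))\<^sup>2 = (q * y) * (y * x\<^sup>2 / q)"
      using nzs by (simp add: y_eq power2_eq_square)
    hence "norm (a / (b * c)) ^ 2 = norm (q * y) * norm (y * x\<^sup>2 / q)"
      by (simp only: norm_power [symmetric] norm_mult [symmetric])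
    also have "\<dots> < 1 * 1" using small by (intro mult_strict_mono) auto
    finally show ?thesis by (simp add: power_less_one_iff)
  qed
  hence abc: "1 - a / (b * c) \<noteq> 0" by auto
  note t4 = psi4_term[of sqrt_a b c, unfolded sq, OF psi4 s_nz(1) nzs(3,4)]
  note t8 = psi8_term[of sqrt_ax sqrt_aq sqrt_a "b * x" "c * x" x, unfolded sq, OF psi8 s_nz _ _ refl]
  \<comment> \<open>The power of x released by rescaling the \<open>hx\<close> factors turns y/q
    into the argument of both bilateral series.\<close>
  have xpow: "(y / q) powi k * x powi (2 * k) = ?z powi k" for k
  proof -
    have "(y / q) powi k * x powi (2 * k) = (y / q * x\<^sup>2) powi k"
      by (simp only: power_int_mult power_int_mult_distrib power_int_numeral)
    also have "y / q * x\<^sup>2 = ?z" using yx by (simp only: mult.commute)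
    finally show ?thesis .
  qed

  define D8 where "D8 = (1 - a * x) * P (1 / a) * P (a * x\<^sup>2) * P (q / (b * x)) * P (q / (c * x)) *
    P (a * q / b) * P (a * q / c)"
  let ?T8 = "psi_term
    [q * sqrt_ax, - q * sqrt_ax, sqrt_aq, - sqrt_aq, q * sqrt_a, - q * sqrt_a, b * x, c * x]
    [sqrt_ax, - sqrt_ax, x * sqrt_aq, - x * sqrt_aq, x * sqrt_a, - x * sqrt_a, a * q / b, a * q / c] q ?z"
  have T8: "?T8 k = W x k / D8" for k
  proof -
    have 1: "hx (a * x * q) x (2 * k) = x powi (2 * k) * hx (a * q) 1 (2 * k)"
      using nzs hx_scale[of x "a * x * q" "2 * k"] by simp
    have 2: "a * x * q / (b * x) = a * q / b" "a * x * q / (c * x) = a * q / c"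
      "a * x * x = a * x\<^sup>2" using nzs by (simp_all add: power2_eq_square)
    have W_eq: "W x k = (1 - a * x * q powi (2 * k)) * (hx (b * x) 1 k * P (a * q / b * q powi k)) *
      (hx (c * x) 1 k * P (a * q / c * q powi k)) *
      (hx (a * q) 1 (2 * k) * P (a * x\<^sup>2 * q powi (2 * k))) * ((y / q) powi k * x powi (2 * k))"
      unfolding W_def base_def 1 2 by (simp only: mult_ac)
    show ?thesis unfolding W_eq xpow D8_def by (rule t8(1)) (use nzs in simp_all)
  qed
  have W_sum: "W x summable_on UNIV"
    by (rule abs_summable_summable[OF W_abs_summable[OF nzs(5) small(2)]])
  have T8_fun: "?T8 = (\<lambda>k. W x k * inverse D8)"
    by (rule ext, rule T8[unfolded divide_inverse[of _ D8]])
  have conv8: "?T8 summable_on UNIV"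
    unfolding T8_fun by (intro summable_on_cmult_left W_sum)
  have S8: "infsum ?T8 UNIV = infsum (W x) UNIV / D8"
    unfolding T8_fun divide_inverse[of _ D8] by (rule infsum_cmult_left')

  define D4 where "D4 = (1 - a) * P (q / b) * P (q / c) * P (a * q / b) * P (a * q / c)"
  let ?T4 = "psi_term [q * sqrt_a, - q * sqrt_a, b, c] [sqrt_a, - sqrt_a, a * q / b, a * q / c] q ?z"
  have T4_fun: "?T4 = (\<lambda>k. (1 - a * q powi (2 * k)) * (hx b 1 k * P (a * q / b * q powi k)) *
      (hx c 1 k * P (a * q / c * q powi k)) * ?z powi k * inverse D4)"
    by (rule ext, rule t4[folded D4_def, unfolded divide_inverse[of _ D4]])
  have V_eq: "V x k = (hx b 1 k * P (a / b * q powi k)) * (hx c 1 k * P (a / c * q powi k)) * ?z powi k" for k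
  proof -
    have 1: "hx (b * x) x k = x powi k * hx b 1 k" "hx (c * x) x k = x powi k * hx c 1 k"
      using nzs hx_scale[of x "b * x" k] hx_scale[of x "c * x" k] by simp_all
    have 2: "a * x / (b * x) = a / b" "a * x / (c * x) = a / c" using nzs by simp_all
    have "V x k = (hx b 1 k * P (a / b * q powi k)) * (hx c 1 k * P (a / c * q powi k)) *
      ((y / q) powi k * (x powi k)\<^sup>2)"
      unfolding V_def 1 2 power2_eq_square by (simp only: mult_ac)
    thus ?thesis unfolding powi_double [symmetric] xpow .
  qed
  have V_sum: "V x summable_on UNIV"
    by (rule abs_summable_summable[OF V_abs_summable[OF nzs(5) small(2,1)]])
  have "((\<lambda>k. (1 - a * q powi (2 * k)) * (hx b 1 k * P (a * q / b * q powi k)) *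
      (hx c 1 k * P (a * q / c * q powi k)) * ?z powi k) has_sum
      ((1 - a / (b * c) / ?z) / (1 - a / (b * c)) * infsum (V x) UNIV)) UNIV"
    using V_sum abc nzs unfolding V_eq by (intro bilateral_vwp_sum) auto
  hence "((\<lambda>k. (1 - a * q powi (2 * k)) * (hx b 1 k * P (a * q / b * q powi k)) *
      (hx c 1 k * P (a * q / c * q powi k)) * ?z powi k * inverse D4) has_sum
      ((1 - a / (b * c) / ?z) / (1 - a / (b * c)) * infsum (V x) UNIV * inverse D4)) UNIV"
    by (rule has_sum_cmult_left)
  \<comment> \<open>The resulting factor 1 - q/x matches the first factor of (x/q)_inf, since 1 -
    x/q = -(x/q) (1 - q/x).\<close>
  moreover have "a / (b * c) / ?z = q / x" using nzs by simp
  ultimately have T4: "(?T4 has_sum ((1 - q / x) / (1 - a / (b * c)) * infsum (V x) UNIV * inverse D4)) UNIV"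
    unfolding T4_fun by (simp only:)

  have up8: "0 \<notin> set [q * sqrt_ax, - q * sqrt_ax, sqrt_aq, - sqrt_aq, q * sqrt_a, - q * sqrt_a, b * x, c * x]"
    using nzs sq s_nz by auto
  have p34: "P (q / (b * x)) \<noteq> 0" "P (q / (c * x)) \<noteq> 0"
    by (rule psi_term_eq(2)[OF psi8 up8], simp)+
  \<comment> \<open>The lower parameters s and -s at exponent 0 give the two factors of 1 - s^2, for
    s a root of ax or of a.\<close>
  have ax: "1 - a * x \<noteq> 0" and a1: "1 - a \<noteq> 0"
  proof -
    have root: "1 - s\<^sup>2 \<noteq> 0" if "1 - s * q ^ 0 \<noteq> 0" "1 - (- s) * q ^ 0 \<noteq> 0" for s
    proof -
      have "1 - s\<^sup>2 = (1 - s * q ^ 0) * (1 - (- s) * q ^ 0)"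
        by (simp add: algebra_simps power2_eq_square)
      thus ?thesis using that by (simp only: mult_eq_0_iff simp_thms)
    qed
    note d8 = psi8[unfolded psi_denoms_nonzero_def, THEN conjunct2, rule_format]
      and d4 = psi4[unfolded psi_denoms_nonzero_def, THEN conjunct2, rule_format]
    have "1 - sqrt_ax\<^sup>2 \<noteq> 0" by (rule root; rule d8; simp)
    moreover have "1 - sqrt_a\<^sup>2 \<noteq> 0" by (rule root; rule d4; simp)
    ultimately  show "1 - a * x \<noteq> 0" "1 - a \<noteq> 0" unfolding sq .
  qed
  have infs_den: "P (q / b) * (P (q / c) * (P (a * q / (b * c * x)) * (P (q / (a * x)) *
      (P (a * q * x) * P (x\<^sup>2 / q))))) \<noteq> 0"
    using den by (simp add: qpoch_infs_def)
  have P1a: "P (1 / a) = (1 - 1 / a) * P (q / a)" and P1ax: "P (1 / (a * x)) = (1 - 1 / (a * x)) * P (q / (a * x))"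
    and Pxq: "P (x / q) = (1 - x / q) * P x" and Pabc: "P (a / (b * c)) = (1 - a / (b * c)) * P (a * q / (b * c))"
    using P_step[of "1 / a"] P_step[of "1 / (a * x)"] P_step[of "x / q"] P_step[of "a / (b * c)"] nzs
    by simp_all
  have core: "P x * ((1 - a / (b * c)) * P (a * q / (b * c))) * infsum (W x) UNIV =
    - q * P (x\<^sup>2 / q) * P (a * q * x) * ((1 - 1 / (a * x)) * P (q / (a * x))) * P (a * q / (b * c * x)) *
    infsum (V x) UNIV"
  proof -
    have 1: "x * y = a / (b * c)" "a * x * q = a * q * x" using nzs by (simp_all add: y_eq)
    show ?thesis
      using core_identity[OF small(2,1)] unfolding 1 qy Pabc [symmetric] P1ax [symmetric]
      by (simp only: mult_ac)
  qed
  \<comment> \<open>(1/a)_inf is the product of the nonzero (q/p)_inf over the upper parameters p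
    built from the roots of aq and a, and it contains (q/a)_inf as a factor.\<close>
  have p1: "P (q / a) \<noteq> 0" using t8(2) nzs unfolding P1a by auto
  have p6: "P (a * x\<^sup>2) \<noteq> 0" using t8(3) nzs by auto
  have "psi [q * sqrt_a, - q * sqrt_a, b, c] [sqrt_a, - sqrt_a, a * q / b, a * q / c] q ?z =
      (1 - q / x) / (1 - a / (b * c)) * infsum (V x) UNIV * inverse D4"
    unfolding psi_def by (rule infsumI[OF T4])
  also have "\<dots> = P (q / a) * (P (a * q / (b * c)) * (P (q / (b * x)) * (P (q / (c * x)) *
        ((1 - x / q) * P x * P (a * x\<^sup>2))))) /
      (P (q / b) * (P (q / c) * (P (a * q / (b * c * x)) * (P (q / (a * x)) *
        (P (a * q * x) * P (x\<^sup>2 / q)))))) * (infsum (W x) UNIV / D8)"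
    unfolding D4_def D8_def P1a
    by (rule psi_prefactor_algebra[OF nzs(2,5,1) a1 ax abc p1 p34 p6 infs_den core])
  finally have main: "psi [q * sqrt_a, - q * sqrt_a, b, c] [sqrt_a, - sqrt_a, a * q / b, a * q / c] q ?z = \<dots>" .
  have "?T4 summable_on UNIV" using T4 by (rule has_sum_imp_summable)
  with conv8 main show ?thesis
    unfolding psi_converges_def psi_def S8 by (simp add: qpoch_infs_def Pxq mult.assoc)
qed

end
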